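(* A monoid variety is a cancellable element of the lattice $\mathbb{MON}$ of all monoid varieties if and only if it coincides with one of the varieties $\mathbf{T}$, $\mathbf{SL}$, $\mathbf{C}_2$, $\mathbf{D}$ or $\mathbf{MON}$.
   Context: Monoids are considered as semigroups with an identity element that is fixed by a 0-ary operation. Thus a monoid variety is a class of monoids definable by identities $\mathbf u\approx\mathbf v$, where $\mathbf u,\mathbf v$ are words (possibly empty, the empty word being interpreted as the identity element) over a countably infinite alphabet. $\mathbb{MON}$ denotes the lattice of all monoid varieties ordered by inclusion; the meet is intersection and the join of two varieties is the smallest monoid variety containing both. An element $x$ of a lattice $L$ is cancellable if for all $y,z\in L$: $x\vee y=x\vee z$ and $x\wedge y=x\wedge z$ together imply $y=z$. For an identity system $\Sigma$, $\operatorname{var}\Sigma$ denotes the variety of monoids defined by $\Sigma$. $\mathbf{T}$ is the variety of trivial monoids, $\mathbf{SL}$ is the variety of semilattice monoids (commutative idempotent monoids), $\mathbf{MON}$ is the variety of all monoids, and \[\mathbf C_2=\operatorname{var}\{x^2\approx x^3,\ xy\approx yx\},\qquad \mathbf D=\operatorname{var}\{x^2\approx x^3,\ x^2y\approx xyx\approx yx^2\}.\] *)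

theory Defs
  imports "HOL-Algebra.Group" "HOL-Library.Countable_Set"
begin

section \<open>Words, identities and monoid varieties\<close>

text \<open>
  Words are lists over the countably infinite alphabet \<open>nat\<close>; the empty list is the empty word,
  which denotes the identity element.  An identity \<open>u \<approx> v\<close> is the pair \<open>(u, v)\<close>.
\<close>

type_synonym identity = "nat list \<times> nat list"

definition word_val :: "('a, 'm) monoid_scheme \<Rightarrow> (nat \<Rightarrow> 'a) \<Rightarrow> nat list \<Rightarrow> 'a"
  where "word_val M \<phi> w = foldr (\<lambda>x a. \<phi> x \<otimes>\<^bsub>M\<^esub> a) w \<one>\<^bsub>M\<^esub>"

definition satisfies :: "('a, 'm) monoid_scheme \<Rightarrow> identity \<Rightarrow> bool"
  where "satisfies M e \<longleftrightarrow>
    (\<forall>\<phi> \<in> UNIV \<rightarrow> carrier M. word_val M \<phi> (fst e) = word_val M \<phi> (snd e))"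

text \<open>
  HOL has no class of all monoids across all types, so classes of monoids are formed inside
  a universe: all monoids whose carrier is a subset of a type \<open>'a\<close>.  For infinite \<open>'a\<close> nothing is
  lost, because a monoid refuting an identity has a countable submonoid refuting it, and a
  countable monoid has a copy on \<open>'a\<close> (lemmas \<open>refuting_monoid_in_universe\<close> and
  \<open>var_mono_universe_independent\<close> below).
\<close>

definition var :: "identity set \<Rightarrow> 'a monoid set"
  where "var \<Sigma> = {M. monoid M \<and> (\<forall>e \<in> \<Sigma>. satisfies M e)}"

definition monoid_variety :: "'a monoid set \<Rightarrow> bool"
  where "monoid_variety V \<longleftrightarrow> (\<exists>\<Sigma>. V = var \<Sigma>)"

definition MON_lattice :: "'a monoid set gorder"
  where "MON_lattice = \<lparr>carrier = {V. monoid_variety V}, eq = (=), le = (\<subseteq>)\<rparr>"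

definition cancellable :: "('l, 'c) gorder_scheme \<Rightarrow> 'l \<Rightarrow> bool"
  where "cancellable L x \<longleftrightarrow> x \<in> carrier L \<and>
    (\<forall>y \<in> carrier L. \<forall>z \<in> carrier L.
       x \<squnion>\<^bsub>L\<^esub> y = x \<squnion>\<^bsub>L\<^esub> z \<and> x \<sqinter>\<^bsub>L\<^esub> y = x \<sqinter>\<^bsub>L\<^esub> z \<longrightarrow> y = z)"

section \<open>The five varieties\<close>

definition T_var :: "'a monoid set"
  where "T_var = {M. monoid M \<and> carrier M = {\<one>\<^bsub>M\<^esub>}}"

definition SL_var :: "'a monoid set"
  where "SL_var = {M. comm_monoid M \<and> (\<forall>x \<in> carrier M. x \<otimes>\<^bsub>M\<^esub> x = x)}"

definition MON_var :: "'a monoid set"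
  where "MON_var = {M. monoid M}"

text \<open>In the next two definitions the letter \<open>x\<close> is \<open>0\<close> and the letter \<open>y\<close> is \<open>1\<close>.\<close>

definition C2_var :: "'a monoid set"
  where "C2_var = var {([0,0], [0,0,0]), ([0,1], [1,0])}"

definition D_var :: "'a monoid set"
  where "D_var = var {([0,0], [0,0,0]), ([0,0,1], [0,1,0]), ([0,1,0], [1,0,0])}"

section \<open>Sanity checks\<close>

lemma word_val_simps [simp]:
  "word_val M \<phi> [] = \<one>\<^bsub>M\<^esub>"
  "word_val M \<phi> (x # w) = \<phi> x \<otimes>\<^bsub>M\<^esub> word_val M \<phi> w"
  by (simp_all add: word_val_def)

lemma (in monoid) word_val_closed [simp]:
  "\<phi> \<in> UNIV \<rightarrow> carrier G \<Longrightarrow> word_val G \<phi> w \<in> carrier G"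
  by (induction w) auto

lemma (in monoid) word_val_append:
  "\<phi> \<in> UNIV \<rightarrow> carrier G \<Longrightarrow> word_val G \<phi> (u @ v) = word_val G \<phi> u \<otimes> word_val G \<phi> v"
proof (induction u)
  case (Cons a u)
  then have "\<phi> a \<in> carrier G" by auto
  with Cons show ?case by (simp add: m_assoc)
qed simp

lemma T_var_eq: "T_var = var {([0], [])}"
proof -
  have "carrier M = {\<one>\<^bsub>M\<^esub>} \<longleftrightarrow> satisfies M ([0], [])" if "monoid M" for M :: "'a monoid"
  proof -
    interpret monoid M by fact
    show ?thesis
    proof
      assume "satisfies M ([0], [])"
      then have "x = \<one>\<^bsub>M\<^esub>" if "x \<in> carrier M" for x
        using that by (auto simp: satisfies_def Pi_def dest!: spec[of _ "\<lambda>_. x"])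
      then show "carrier M = {\<one>\<^bsub>M\<^esub>}" by auto
    qed (auto simp: satisfies_def Pi_def)
  qed
  then show ?thesis by (auto simp: T_var_def var_def)
qed

lemma SL_var_eq: "SL_var = var {([0,0], [0]), ([0,1], [1,0])}"
proof -
  have "comm_monoid M \<and> (\<forall>x\<in>carrier M. x \<otimes>\<^bsub>M\<^esub> x = x) \<longleftrightarrow>
      satisfies M ([0,0], [0]) \<and> satisfies M ([0,1], [1,0])" if "monoid M" for M :: "'a monoid"
  proof -
    interpret monoid M by fact
    show ?thesis
    proof
      assume *: "satisfies M ([0,0], [0]) \<and> satisfies M ([0,1], [1,0])"
      have "x \<otimes>\<^bsub>M\<^esub> x = x" if "x \<in> carrier M" for x
        using * that by (auto simp: satisfies_def Pi_def dest!: spec[of _ "\<lambda>_. x"])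
      moreover have "x \<otimes>\<^bsub>M\<^esub> y = y \<otimes>\<^bsub>M\<^esub> x" if "x \<in> carrier M" "y \<in> carrier M" for x y
        using * that
        by (auto simp: satisfies_def Pi_def dest!: spec[of _ "\<lambda>n. if n = 0 then x else y"])
      ultimately show "comm_monoid M \<and> (\<forall>x\<in>carrier M. x \<otimes>\<^bsub>M\<^esub> x = x)"
        by (auto intro: monoid_comm_monoidI)
    next
      assume *: "comm_monoid M \<and> (\<forall>x\<in>carrier M. x \<otimes>\<^bsub>M\<^esub> x = x)"
      then interpret comm_monoid M by blast
      show "satisfies M ([0,0], [0]) \<and> satisfies M ([0,1], [1,0])"
        using * by (auto simp: satisfies_def Pi_def m_comm)
    qed
  qed
  moreover have "monoid M" if "comm_monoid M" for M :: "'a monoid"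
    using that by (rule comm_monoid.axioms)
  ultimately show ?thesis by (auto simp: SL_var_def var_def)
qed

lemma MON_var_eq: "MON_var = var {}"
  by (simp add: MON_var_def var_def)

lemma monoid_variety_five:
  "monoid_variety T_var" "monoid_variety SL_var" "monoid_variety C2_var"
  "monoid_variety D_var" "monoid_variety MON_var"
  by (auto simp: monoid_variety_def T_var_eq SL_var_eq C2_var_def D_var_def MON_var_eq)

text \<open>The meet is intersection, and the join of two varieties is defined by their common identities.\<close>

lemma var_Un: "var (\<Sigma> \<union> \<Sigma>') = var \<Sigma> \<inter> var \<Sigma>'"
  by (auto simp: var_def)

lemma monoid_variety_Int: "monoid_variety V \<Longrightarrow> monoid_variety W \<Longrightarrow> monoid_variety (V \<inter> W)"
  unfolding monoid_variety_def by (metis var_Un)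

definition common_identities :: "'a monoid set \<Rightarrow> identity set"
  where "common_identities K = {e. \<forall>M \<in> K. satisfies M e}"

lemma greatest_MON_lattice:
  assumes "monoid_variety V" "monoid_variety W"
  shows "greatest MON_lattice (V \<inter> W) (Lower MON_lattice {V, W})"
  using assms monoid_variety_Int[OF assms]
  by (auto simp: greatest_def Lower_def MON_lattice_def)

lemma least_MON_lattice:
  assumes "monoid_variety V" "monoid_variety W"
  shows "least MON_lattice (var (common_identities (V \<union> W))) (Upper MON_lattice {V, W})"
proof -
  have "V \<union> W \<subseteq> var (common_identities (V \<union> W))"
    using assms by (auto simp: monoid_variety_def var_def common_identities_def)
  moreover have "var (common_identities (V \<union> W)) \<subseteq> U" if "monoid_variety U" "V \<subseteq> U" "W \<subseteq> U" for U
  proof -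
    obtain \<Sigma> where U: "U = var \<Sigma>" using \<open>monoid_variety U\<close> by (auto simp: monoid_variety_def)
    then have "\<Sigma> \<subseteq> common_identities (V \<union> W)"
      using that by (auto simp: common_identities_def var_def)
    then show ?thesis by (auto simp: U var_def)
  qed
  moreover have "monoid_variety (var (common_identities (V \<union> W)))"
    unfolding monoid_variety_def by blast
  ultimately show ?thesis
    using assms unfolding least_def Upper_def by (simp add: MON_lattice_def)
qed

lemma lattice_MON_lattice: "lattice MON_lattice"
proof -
  have "partial_order MON_lattice"
    by unfold_locales (auto simp: MON_lattice_def)
  moreover have "carrier MON_lattice = {V. monoid_variety V}"
    by (simp add: MON_lattice_def)
  ultimately show ?thesis
    unfolding lattice_def upper_semilattice_def lower_semilattice_def
      upper_semilattice_axioms_def lower_semilattice_axioms_def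
    using greatest_MON_lattice least_MON_lattice by blast
qed

lemma meet_MON_lattice:
  assumes "monoid_variety V" "monoid_variety W"
  shows "V \<sqinter>\<^bsub>MON_lattice\<^esub> W = V \<inter> W"
proof -
  interpret lattice MON_lattice by (rule lattice_MON_lattice)
  show ?thesis
    using greatest_MON_lattice[OF assms] greatest_unique
    by (auto simp: meet_def inf_def intro!: some_equality)
qed

lemma join_MON_lattice:
  assumes "monoid_variety V" "monoid_variety W"
  shows "V \<squnion>\<^bsub>MON_lattice\<^esub> W = var (common_identities (V \<union> W))"
proof -
  interpret lattice MON_lattice by (rule lattice_MON_lattice)
  show ?thesis
    using least_MON_lattice[OF assms] least_unique
    by (auto simp: join_def sup_def intro!: some_equality)
qed

text \<open>Independence of the universe.\<close>

lemma refuting_monoid_in_universe: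
  fixes M :: "'b monoid"
  assumes inf: "infinite (UNIV :: 'a set)"
    and M: "M \<in> var \<Sigma>" and "\<not> satisfies M e"
  shows "\<exists>N :: 'a monoid. N \<in> var \<Sigma> \<and> \<not> satisfies N e"
proof -
  interpret M: monoid M using M by (simp add: var_def)
  obtain \<phi> where \<phi>: "\<phi> \<in> UNIV \<rightarrow> carrier M"
    and neq: "word_val M \<phi> (fst e) \<noteq> word_val M \<phi> (snd e)"
    using assms(3) by (auto simp: satisfies_def)
  define S where "S = range (word_val M \<phi>)"
  have "countable S" by (simp add: S_def)
  obtain h :: "nat \<Rightarrow> 'a" where "inj h"
    using infinite_countable_subset[OF inf] by blast
  define f where "f = h \<circ> to_nat_on S"
  define g where "g = inv_into S f"
  have f: "inj_on f S"
    unfolding f_def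
    using \<open>inj h\<close> \<open>countable S\<close> by (intro comp_inj_on) (auto intro: inj_on_subset)
  have gf [simp]: "g (f s) = s" if "s \<in> S" for s
    using f that by (simp add: g_def)
  have SM: "S \<subseteq> carrier M" using \<phi> by (auto simp: S_def)
  have S1 [simp]: "\<one>\<^bsub>M\<^esub> \<in> S"
    unfolding S_def by (metis word_val_simps(1) rangeI)
  have Sm [simp]: "s \<otimes>\<^bsub>M\<^esub> t \<in> S" if "s \<in> S" "t \<in> S" for s t
  proof -
    obtain u v where "s = word_val M \<phi> u" "t = word_val M \<phi> v"
      using \<open>s \<in> S\<close> \<open>t \<in> S\<close> by (auto simp: S_def)
    then have "s \<otimes>\<^bsub>M\<^esub> t = word_val M \<phi> (u @ v)"
      using \<phi> by (simp add: M.word_val_append)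
    then show ?thesis by (simp add: S_def)
  qed
  define N :: "'a monoid"
    where "N = \<lparr>carrier = f ` S, mult = (\<lambda>x y. f (g x \<otimes>\<^bsub>M\<^esub> g y)), one = f \<one>\<^bsub>M\<^esub>\<rparr>"
  have "monoid N"
    using SM by unfold_locales (auto simp: N_def M.m_assoc subset_iff)
  have val: "word_val N \<psi> w = f (word_val M (g \<circ> \<psi>) w) \<and> word_val M (g \<circ> \<psi>) w \<in> S"
    if "\<psi> \<in> UNIV \<rightarrow> carrier N" for \<psi> w
  proof (induction w)
    case (Cons a w)
    have "\<psi> a \<in> f ` S" using that by (auto simp: N_def)
    with Cons show ?case by (auto simp: N_def)
  qed (simp add: N_def)
  have "satisfies N d" if "satisfies M d" for d
  proof -
    have "word_val N \<psi> (fst d) = word_val N \<psi> (snd d)" if \<psi>: "\<psi> \<in> UNIV \<rightarrow> carrier N" for \<psi>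
    proof -
      have "(g \<circ> \<psi>) n \<in> carrier M" for n
      proof -
        have "\<psi> n \<in> f ` S" using \<psi> by (auto simp: N_def)
        then show ?thesis using SM by auto
      qed
      then have "g \<circ> \<psi> \<in> UNIV \<rightarrow> carrier M" by blast
      then show ?thesis using \<open>satisfies M d\<close> val[OF \<psi>] by (simp add: satisfies_def)
    qed
    then show ?thesis by (simp add: satisfies_def)
  qed
  then have "N \<in> var \<Sigma>" using M \<open>monoid N\<close> by (auto simp: var_def)
  moreover have "\<not> satisfies N e"
  proof
    assume *: "satisfies N e"
    have \<phi>S: "\<phi> n \<in> S" for n
    proof -
      have "\<phi> n = word_val M \<phi> [n]" using \<phi> by (simp add: Pi_iff)
      then show ?thesis unfolding S_def by blast
    qed
    then have "f \<circ> \<phi> \<in> UNIV \<rightarrow> carrier N" by (auto simp: N_def)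
    moreover have "g \<circ> (f \<circ> \<phi>) = \<phi>" using \<phi>S by (auto simp: fun_eq_iff)
    ultimately have "f (word_val M \<phi> (fst e)) = f (word_val M \<phi> (snd e))"
      using * val[of "f \<circ> \<phi>"] unfolding satisfies_def by metis
    then show False
      using f neq by (auto simp: S_def inj_on_def)
  qed
  ultimately show ?thesis by blast
qed

lemma var_mono_universe_independent:
  assumes "infinite (UNIV :: 'a set)" "infinite (UNIV :: 'b set)"
  shows "(var \<Sigma> :: 'a monoid set) \<subseteq> var \<Sigma>' \<longleftrightarrow> (var \<Sigma> :: 'b monoid set) \<subseteq> var \<Sigma>'"
proof -
  have iff1: "(var \<Sigma> :: 'a monoid set) \<subseteq> var \<Sigma>' \<longleftrightarrow>
      (\<forall>e \<in> \<Sigma>'. \<forall>M \<in> (var \<Sigma> :: 'a monoid set). satisfies M e)"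
    by (auto simp: var_def)
  have iff2: "(var \<Sigma> :: 'b monoid set) \<subseteq> var \<Sigma>' \<longleftrightarrow>
      (\<forall>e \<in> \<Sigma>'. \<forall>M \<in> (var \<Sigma> :: 'b monoid set). satisfies M e)"
    by (auto simp: var_def)
  show ?thesis
    unfolding iff1 iff2
    using refuting_monoid_in_universe[OF assms(1), where ?'b = 'b, of _ \<Sigma>]
      refuting_monoid_in_universe[OF assms(2), where ?'b = 'a, of _ \<Sigma>]
    by blast
qed

end

theory Submission
  imports Defs
begin

text \<open>
  A variety is determined by the fully invariant congruence of its identities on the free monoid
  (\<open>common_identities_var\<close>); the join of two varieties has the intersection of their
  congruences, and the meet has the congruence that their identities generate together.

  \<^bold>\<open>The five varieties are cancellable.\<close>  The interesting ones form the chain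
  \<open>SL \<subseteq> C\<^sub>2 \<subseteq> D\<close>.  Let \<open>V\<close> be one of them, with \<open>V \<or> Y = V \<or> Z\<close> and
  \<open>V \<and> Y = V \<and> Z\<close>.  If \<open>V \<subseteq> Y\<close>, then \<open>V \<subseteq> Z\<close> and \<open>Y = V \<or> Y = V \<or> Z = Z\<close>.
  Otherwise the first member of the chain that \<open>Y\<close> does not contain lies inside \<open>V\<close>, so \<open>Z\<close> has
  the same first missing member.  Missing \<open>SL\<close> means \<open>x\<^sup>n \<approx> 1\<close>, missing \<open>C\<^sub>2\<close> means
  \<open>x \<approx> x\<^sup>k\<close> with \<open>k \<ge> 2\<close>, and missing \<open>D\<close> means commutativity.  In each case an
  identity of \<open>Y\<close> can be rewritten, by an identity that \<open>Y\<close> and \<open>Z\<close> share, into one that \<open>D\<close>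
  satisfies: multiply both sides by a power of all letters, raise every letter to a power, or
  sort both sides.  The rewritten identity holds in \<open>V \<or> Y = V \<or> Z\<close>, hence in \<open>Z\<close>, where it
  can be rewritten back.

  \<^bold>\<open>No other variety is cancellable.\<close>  Given \<open>V\<close>, the varieties \<open>Y\<close> and \<open>Z\<close> that refute
  cancellability are huge.  They share all identities that respect some labelling \<open>g\<close> of the words
  (\<open>syntactic g\<close>), and \<open>Y\<close> has one more identity \<open>e\<^sub>1\<close>, \<open>Z\<close> one more identity \<open>e\<^sub>2\<close>.  The
  labels are chosen so that \<open>e\<^sub>i\<close> only merges labels of words that \<open>V\<close> separates; this makes the
  two joins equal.  The two meets are equal as soon as \<open>e\<^sub>1\<close> and \<open>e\<^sub>2\<close> imply each other in the
  presence of \<open>V\<close> and \<open>syntactic g\<close> (\<open>not_cancellable_criterion\<close>).  Three choices of labels give, for cancellable \<open>V\<close>: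

  \<^item> for \<open>n \<noteq> m\<close>, if \<open>V\<close> identifies two of the words with \<open>n\<close> letters \<open>x\<close> and \<open>m\<close> letters
    \<open>t\<close>, it identifies all of them (\<open>cancellable_two_letter_collapse\<close>);
  \<^item> if \<open>V\<close> satisfies \<open>x\<^sup>n\<^sup>-\<^sup>1t\<^sup>mx \<approx> x\<^sup>nt\<^sup>m\<close> with \<open>n \<ge> 2\<close> and \<open>m \<ge> 1\<close>, it satisfies
    \<open>x\<^sup>n \<approx> x\<^sup>n\<^sup>+\<^sup>k\<close> for some \<open>k \<ge> 1\<close> (\<open>cancellable_imp_periodic_at\<close>);
  \<^item> if \<open>V\<close> is periodic, it satisfies \<open>x\<^sup>r \<approx> x\<^sup>r\<^sup>+\<^sup>1\<close> for some \<open>r\<close>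
    (\<open>cancellable_periodic_imp_aperiodic\<close>).

  A nontrivial identity of \<open>V\<close> yields a nontrivial one in two letters, so the first two facts make
  \<open>V\<close> periodic and the third makes it aperiodic.  Let \<open>s\<close> be least with \<open>x\<^sup>s \<approx> x\<^sup>s\<^sup>+\<^sup>1\<close>.  By
  the first fact \<open>x\<^sup>s\<close> is central.  For \<open>s \<ge> 3\<close> the second fact with \<open>n = s - 1\<close> and
  \<open>m = s\<close> contradicts the choice of \<open>s\<close>; for \<open>s \<le> 2\<close>, using the first fact again when
  \<open>s = 2\<close>, one gets \<open>V \<subseteq> D\<close>, and \<open>D\<close> has only the subvarieties \<open>T\<close>, \<open>SL\<close>,
  \<open>C\<^sub>2\<close> and \<open>D\<close>.
\<close>

section \<open>Fully invariant congruences\<close>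

definition subst_word :: "(nat \<Rightarrow> nat list) \<Rightarrow> nat list \<Rightarrow> nat list"
  where "subst_word \<phi> w = concat (map \<phi> w)"

lemma subst_word_simps [simp]:
  "subst_word \<phi> [] = []"
  "subst_word \<phi> (x # w) = \<phi> x @ subst_word \<phi> w"
  "subst_word \<phi> (u @ v) = subst_word \<phi> u @ subst_word \<phi> v"
  "subst_word \<phi> (replicate n x) = concat (replicate n (\<phi> x))"
  by (simp_all add: subst_word_def)

lemma subst_word_comp:
  "subst_word \<phi> (subst_word \<psi> w) = subst_word (\<lambda>x. subst_word \<phi> (\<psi> x)) w"
  by (induction w) auto

lemma subst_word_id [simp]: "subst_word (\<lambda>x. [x]) w = w"
  by (induction w) auto

lemma concat_replicate_single [simp]: "concat (replicate n [x]) = replicate n x"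
  by (induction n) auto

lemma concat_replicate_replicate [simp]:
  "concat (replicate n (replicate m x)) = replicate (n * m) x"
  by (induction n) (auto simp: replicate_add)

lemma length_concat_replicate [simp]: "length (concat (replicate n u)) = n * length u"
  by (induction n) auto

lemma count_list_concat_replicate [simp]:
  "count_list (concat (replicate n u)) x = n * count_list u x"
  by (induction n) auto

lemma count_list_replicate [simp]: "count_list (replicate n x) y = (if x = y then n else 0)"
  by (induction n) auto

locale fully_invariant =
  fixes \<alpha> :: "identity set"
  assumes refl [simp, intro]: "(p, p) \<in> \<alpha>"
    and sym: "(p, q) \<in> \<alpha> \<Longrightarrow> (q, p) \<in> \<alpha>"
    and trans [trans]: "(p, q) \<in> \<alpha> \<Longrightarrow> (q, r) \<in> \<alpha> \<Longrightarrow> (p, r) \<in> \<alpha>"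
    and cong: "(p, q) \<in> \<alpha> \<Longrightarrow> (c @ p @ d, c @ q @ d) \<in> \<alpha>"
    and subst: "(p, q) \<in> \<alpha> \<Longrightarrow> (subst_word \<phi> p, subst_word \<phi> q) \<in> \<alpha>"
begin

lemma cong_left: "(p, q) \<in> \<alpha> \<Longrightarrow> (c @ p, c @ q) \<in> \<alpha>"
  using cong[of p q c "[]"] by simp

lemma cong_right: "(p, q) \<in> \<alpha> \<Longrightarrow> (p @ d, q @ d) \<in> \<alpha>"
  using cong[of p q "[]" d] by simp

lemma append: "(p, q) \<in> \<alpha> \<Longrightarrow> (p', q') \<in> \<alpha> \<Longrightarrow> (p @ p', q @ q') \<in> \<alpha>"
  using trans cong_left cong_right by blast

lemma subst_pointwise:
  assumes "\<And>x. (\<phi> x, \<psi> x) \<in> \<alpha>"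
  shows "(subst_word \<phi> w, subst_word \<psi> w) \<in> \<alpha>"
  by (induction w) (auto intro: append assms)

lemma replicate_absorb:
  assumes "(replicate s x, replicate (s + 1) x) \<in> \<alpha>" "s \<le> a" "s \<le> b"
  shows "(replicate a x, replicate b x) \<in> \<alpha>"
proof -
  have *: "(replicate s x, replicate (s + l) x) \<in> \<alpha>" for l
  proof (induction l)
    case (Suc l)
    then show ?case
      using trans[OF assms(1)] cong_left[of "replicate s x" "replicate (s + l) x" "[x]"] by simp
  qed simp
  show ?thesis
    using *[of "a - s"] *[of "b - s"] assms(2,3) sym trans by (metis le_add_diff_inverse)
qed

end

lemma (in monoid) word_val_subst_word:
  assumes "\<psi> \<in> UNIV \<rightarrow> carrier G"
  shows "word_val G \<psi> (subst_word \<phi> w) = word_val G (\<lambda>x. word_val G \<psi> (\<phi> x)) w"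
  using assms by (induction w) (auto simp: word_val_append)

lemma fully_invariant_common_identities:
  assumes "\<And>M. M \<in> K \<Longrightarrow> monoid M"
  shows "fully_invariant (common_identities K)"
proof
  fix p q c d :: "nat list" and \<phi> :: "nat \<Rightarrow> nat list"
  assume pq: "(p, q) \<in> common_identities K"
  show "(c @ p @ d, c @ q @ d) \<in> common_identities K"
    using pq assms
    by (auto simp: common_identities_def satisfies_def monoid.word_val_append)
  have "satisfies M (subst_word \<phi> p, subst_word \<phi> q)" if "M \<in> K" for M
  proof -
    interpret monoid M using assms that .
    have "(\<lambda>x. word_val M \<psi> (\<phi> x)) \<in> UNIV \<rightarrow> carrier M" if "\<psi> \<in> UNIV \<rightarrow> carrier M" for \<psi>
      using that by simp
    then show ?thesis
      using pq \<open>M \<in> K\<close> by (simp add: common_identities_def satisfies_def word_val_subst_word)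
  qed
  then show "(subst_word \<phi> p, subst_word \<phi> q) \<in> common_identities K"
    by (simp add: common_identities_def)
qed (auto simp: common_identities_def satisfies_def)

text \<open>
  The completeness theorem of equational logic: the quotient of the free monoid by \<open>\<alpha>\<close>
  satisfies exactly the identities in \<open>\<alpha>\<close>.  Its carrier consists of sets of words, so a failing
  identity is carried over to a monoid on \<open>'a\<close>; this is where infinity of \<open>'a\<close> enters.
\<close>

lemma common_identities_var:
  assumes inf: "infinite (UNIV :: 'a set)" and "fully_invariant \<alpha>"
  shows "common_identities (var \<alpha> :: 'a monoid set) = \<alpha>"
proof
  interpret fully_invariant \<alpha> by fact
  show "\<alpha> \<subseteq> common_identities (var \<alpha> :: 'a monoid set)"
    by (auto simp: common_identities_def var_def)
  define cl where "cl p = \<alpha> `` {p}" for p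
  have cl_eq: "cl p = cl q \<longleftrightarrow> (p, q) \<in> \<alpha>" for p q
    unfolding cl_def using refl sym trans by blast
  define rep where "rep A = (SOME p. A = cl p)" for A
  have rep: "cl (rep (cl p)) = cl p" for p
    unfolding rep_def by (rule someI[where P = "\<lambda>q. cl p = cl q", symmetric]) simp
  define Q where "Q = \<lparr>carrier = range cl, mult = (\<lambda>A B. cl (rep A @ rep B)), one = cl []\<rparr>"
  have mult: "cl p \<otimes>\<^bsub>Q\<^esub> cl q = cl (p @ q)" for p q
    using rep by (auto simp: Q_def cl_eq intro: append)
  have one: "\<one>\<^bsub>Q\<^esub> = cl []" by (simp add: Q_def)
  have carr: "x \<in> carrier Q \<longleftrightarrow> (\<exists>p. x = cl p)" for x by (auto simp: Q_def)
  interpret Q: monoid Q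
    by unfold_locales (auto simp: carr mult one)
  have val: "word_val Q (\<lambda>x. cl (\<phi> x)) w = cl (subst_word \<phi> w)" for \<phi> w
    by (induction w) (auto simp: one mult)
  have "satisfies Q (p, q) \<longleftrightarrow> (\<forall>\<phi>. (subst_word \<phi> p, subst_word \<phi> q) \<in> \<alpha>)" for p q
  proof -
    have "UNIV \<rightarrow> carrier Q = range (\<lambda>(\<phi> :: nat \<Rightarrow> nat list) x. cl (\<phi> x))"
      by (auto simp: Pi_iff carr choice_iff image_def fun_eq_iff)
    then show ?thesis by (simp add: satisfies_def val cl_eq)
  qed
  then have sat: "satisfies Q (p, q) \<longleftrightarrow> (p, q) \<in> \<alpha>" for p q
    using subst subst_word_id by metis
  then have Q: "Q \<in> var \<alpha>" using Q.monoid_axioms by (auto simp: var_def)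
  show "common_identities (var \<alpha> :: 'a monoid set) \<subseteq> \<alpha>"
  proof
    fix e assume e: "e \<in> common_identities (var \<alpha> :: 'a monoid set)"
    obtain p q where pq: "e = (p, q)" by (cases e)
    show "e \<in> \<alpha>"
      using refuting_monoid_in_universe[OF inf Q, of e] e sat
      by (auto simp: common_identities_def pq)
  qed
qed

lemma var_common_identities:
  assumes "monoid_variety V"
  shows "var (common_identities V) = V"
  using assms by (auto simp: monoid_variety_def common_identities_def var_def)

lemma monoid_variety_monoid: "monoid_variety V \<Longrightarrow> M \<in> V \<Longrightarrow> monoid M"
  by (auto simp: monoid_variety_def var_def)

lemma common_identities_Un: "common_identities (K \<union> L) = common_identities K \<inter> common_identities L"
  by (auto simp: common_identities_def)

lemma common_identities_antimono: "K \<subseteq> L \<Longrightarrow> common_identities L \<subseteq> common_identities K"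
  by (auto simp: common_identities_def)

lemma fully_invariant_identities:
  "monoid_variety V \<Longrightarrow> fully_invariant (common_identities V)"
  by (intro fully_invariant_common_identities monoid_variety_monoid)

lemma variety_subset_var_iff:
  assumes "monoid_variety V"
  shows "V \<subseteq> var \<Sigma> \<longleftrightarrow> \<Sigma> \<subseteq> common_identities V"
  using monoid_variety_monoid[OF assms] by (auto simp: common_identities_def var_def)

lemma variety_subset_iff:
  assumes "monoid_variety V" "monoid_variety W"
  shows "V \<subseteq> W \<longleftrightarrow> common_identities W \<subseteq> common_identities V"
  using variety_subset_var_iff[OF assms(1), of "common_identities W"]
    var_common_identities[OF assms(2)] by simp

text \<open>
  The largest fully invariant congruence that never identifies words with different labels
  \<open>f\<close>: the identities of the syntactic monoid of \<open>f\<close>.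
\<close>

definition syntactic :: "(nat list \<Rightarrow> 'l) \<Rightarrow> identity set"
  where "syntactic f = {(p, q). \<forall>\<phi> c d. f (c @ subst_word \<phi> p @ d) = f (c @ subst_word \<phi> q @ d)}"

lemma fully_invariant_syntactic: "fully_invariant (syntactic f)"
proof
  fix p q c d :: "nat list" and \<phi> :: "nat \<Rightarrow> nat list"
  assume pq: "(p, q) \<in> syntactic f"
  show "(c @ p @ d, c @ q @ d) \<in> syntactic f"
    unfolding syntactic_def
  proof safe
    fix \<psi> :: "nat \<Rightarrow> nat list" and c' d' :: "nat list"
    show "f (c' @ subst_word \<psi> (c @ p @ d) @ d') = f (c' @ subst_word \<psi> (c @ q @ d) @ d')"
      using pq[unfolded syntactic_def, simplified, rule_format,
          of "c' @ subst_word \<psi> c" \<psi> "subst_word \<psi> d @ d'"]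
      by simp
  qed
  show "(subst_word \<phi> p, subst_word \<phi> q) \<in> syntactic f"
    using pq by (auto simp: syntactic_def subst_word_comp)
qed (auto simp: syntactic_def)

lemma syntacticD: "(p, q) \<in> syntactic f \<Longrightarrow> f p = f q"
  unfolding syntactic_def
  by clarify (drule spec[of _ "\<lambda>x. [x]"], drule spec[of _ "[]"], drule spec[of _ "[]"], simp)

lemma common_identities_var_syntactic:
  assumes inf: "infinite (UNIV :: 'a set)" and "\<Sigma> \<subseteq> syntactic f"
    and "(p, q) \<in> common_identities (var \<Sigma> :: 'a monoid set)"
  shows "f p = f q"
proof -
  have "(var (syntactic f) :: 'a monoid set) \<subseteq> var \<Sigma>"
    using assms(2) by (auto simp: var_def)
  then have "(p, q) \<in> common_identities (var (syntactic f) :: 'a monoid set)"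
    using assms(3) by (auto simp: common_identities_def)
  then show ?thesis
    unfolding common_identities_var[OF inf fully_invariant_syntactic] by (rule syntacticD)
qed

text \<open>
  The refuting varieties \<open>Y\<close> and \<open>Z\<close> are defined by \<open>syntactic g\<close> together with \<open>e\<^sub>1\<close> and
  \<open>e\<^sub>2\<close> respectively.  An identity of \<open>Y\<close> lies in \<open>syntactic f\<^sub>1\<close>, and if it also holds in \<open>V\<close> the
  separation hypothesis lifts it to \<open>syntactic g\<close>.  So both joins have the identities
  \<open>common_identities V \<inter> syntactic g\<close>.
\<close>

lemma not_cancellable_criterion:
  fixes V :: "'a monoid set" and g :: "nat list \<Rightarrow> 'l" and f\<^sub>1 f\<^sub>2 :: "nat list \<Rightarrow> 'k"
  assumes inf: "infinite (UNIV :: 'a set)" and V: "monoid_variety V"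
    and coarser: "\<And>p q. g p = g q \<Longrightarrow> f\<^sub>1 p = f\<^sub>1 q" "\<And>p q. g p = g q \<Longrightarrow> f\<^sub>2 p = f\<^sub>2 q"
    and sep: "\<And>p q. (p, q) \<in> common_identities V \<Longrightarrow> f\<^sub>1 p = f\<^sub>1 q \<Longrightarrow> g p = g q"
      "\<And>p q. (p, q) \<in> common_identities V \<Longrightarrow> f\<^sub>2 p = f\<^sub>2 q \<Longrightarrow> g p = g q"
    and e: "e\<^sub>1 \<in> syntactic f\<^sub>1" "e\<^sub>2 \<in> syntactic f\<^sub>2" "e\<^sub>1 \<notin> syntactic f\<^sub>2"
    and meet: "\<And>\<delta>. fully_invariant \<delta> \<Longrightarrow> common_identities V \<subseteq> \<delta> \<Longrightarrow> syntactic g \<subseteq> \<delta> \<Longrightarrow>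
      e\<^sub>1 \<in> \<delta> \<longleftrightarrow> e\<^sub>2 \<in> \<delta>"
  shows "\<not> cancellable MON_lattice V"
proof
  assume canc: "cancellable MON_lattice V"
  define Y where "Y = (var (insert e\<^sub>1 (syntactic g)) :: 'a monoid set)"
  define Z where "Z = (var (insert e\<^sub>2 (syntactic g)) :: 'a monoid set)"
  have var: "monoid_variety Y" "monoid_variety Z"
    unfolding monoid_variety_def Y_def Z_def by blast+
  interpret \<theta>: fully_invariant "common_identities V"
    using V by (rule fully_invariant_identities)
  have ids: "common_identities (var (insert e (syntactic g)) :: 'a monoid set) \<subseteq> syntactic f"
    if "\<And>p q. g p = g q \<Longrightarrow> f p = f q" "e \<in> syntactic f" for f :: "nat list \<Rightarrow> 'k" and e
  proof -
    have "insert e (syntactic g) \<subseteq> syntactic f"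
      using that unfolding syntactic_def by blast
    then have "(var (syntactic f) :: 'a monoid set) \<subseteq> var (insert e (syntactic g))"
      by (auto simp: var_def)
    then have "common_identities (var (insert e (syntactic g)) :: 'a monoid set)
        \<subseteq> common_identities (var (syntactic f) :: 'a monoid set)"
      by (rule common_identities_antimono)
    then show ?thesis
      unfolding common_identities_var[OF inf fully_invariant_syntactic] .
  qed
  have join: "common_identities (V \<union> var (insert e (syntactic g)))
      = common_identities V \<inter> syntactic g"
    if "\<And>p q. g p = g q \<Longrightarrow> f p = f q" "e \<in> syntactic f"
      "\<And>p q. (p, q) \<in> common_identities V \<Longrightarrow> f p = f q \<Longrightarrow> g p = g q"
    for f :: "nat list \<Rightarrow> 'k" and e
  proof -
    have "(p, q) \<in> syntactic g" if "(p, q) \<in> common_identities V" "(p, q) \<in> syntactic f" for p q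
      using that \<theta>.cong[OF \<theta>.subst] \<open>\<And>p q. (p, q) \<in> common_identities V \<Longrightarrow> f p = f q \<Longrightarrow> g p = g q\<close>
      by (auto simp: syntactic_def)
    moreover have "common_identities (V \<union> var (insert e (syntactic g)))
        = common_identities V \<inter> common_identities (var (insert e (syntactic g)) :: 'a monoid set)"
      by (rule common_identities_Un)
    moreover have "syntactic g \<subseteq> common_identities (var (insert e (syntactic g)) :: 'a monoid set)"
      by (auto simp: common_identities_def var_def)
    ultimately show ?thesis using ids[OF that(1,2)] by auto
  qed
  have "common_identities (V \<union> Y) = common_identities V \<inter> syntactic g"
    unfolding Y_def by (rule join[of f\<^sub>1]) (fact coarser e sep)+
  moreover have "common_identities (V \<union> Z) = common_identities V \<inter> syntactic g"
    unfolding Z_def by (rule join[of f\<^sub>2]) (fact coarser e sep)+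
  ultimately have "V \<squnion>\<^bsub>MON_lattice\<^esub> Y = V \<squnion>\<^bsub>MON_lattice\<^esub> Z"
    unfolding join_MON_lattice[OF V var(1)] join_MON_lattice[OF V var(2)] by simp
  moreover have "V \<inter> Y = V \<inter> Z"
  proof -
    have "M \<in> Y \<longleftrightarrow> M \<in> Z" if "M \<in> V" for M
    proof (cases "M \<in> var (syntactic g)")
      case True
      have "fully_invariant (common_identities {M})"
        using monoid_variety_monoid[OF V that] by (intro fully_invariant_common_identities) simp
      moreover have "common_identities V \<subseteq> common_identities {M}"
        using that by (auto simp: common_identities_def)
      moreover have "syntactic g \<subseteq> common_identities {M}"
        using True by (auto simp: common_identities_def var_def)
      ultimately have "satisfies M e\<^sub>1 \<longleftrightarrow> satisfies M e\<^sub>2"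
        using meet[of "common_identities {M}"] by (simp add: common_identities_def)
      then show ?thesis using True by (auto simp: Y_def Z_def var_def)
    qed (auto simp: Y_def Z_def var_def)
    then show ?thesis by blast
  qed
  then have "V \<sqinter>\<^bsub>MON_lattice\<^esub> Y = V \<sqinter>\<^bsub>MON_lattice\<^esub> Z"
    using var V by (simp add: meet_MON_lattice)
  ultimately have "Y = Z"
    using canc var by (auto simp: cancellable_def MON_lattice_def)
  moreover have "e\<^sub>1 \<in> common_identities Y"
    by (auto simp: Y_def common_identities_def var_def)
  ultimately show False
    using ids[of f\<^sub>2 e\<^sub>2] coarser(2) e unfolding Z_def by blast
qed

text \<open>
  The case of a trivial \<open>e\<^sub>2\<close>: here \<open>Y\<close> is a proper subvariety of \<open>Z\<close>, so that \<open>V\<close> is not even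
  a modular element.
\<close>

corollary not_cancellable_refinement:
  fixes V :: "'a monoid set" and f g :: "nat list \<Rightarrow> 'l"
  assumes "infinite (UNIV :: 'a set)" "monoid_variety V"
    and "\<And>p q. g p = g q \<Longrightarrow> f p = f q"
    and "\<And>p q. (p, q) \<in> common_identities V \<Longrightarrow> f p = f q \<Longrightarrow> g p = g q"
    and "e \<in> syntactic f" "e \<notin> syntactic g"
    and "\<And>\<delta>. fully_invariant \<delta> \<Longrightarrow> common_identities V \<subseteq> \<delta> \<Longrightarrow> syntactic g \<subseteq> \<delta> \<Longrightarrow> e \<in> \<delta>"
  shows "\<not> cancellable MON_lattice V"
proof (rule not_cancellable_criterion[of V g f g e "([], [])"])
  show "([], []) \<in> syntactic g"
    using fully_invariant_syntactic by (rule fully_invariant.refl)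
  show "e \<in> \<delta> \<longleftrightarrow> ([], []) \<in> \<delta>"
    if "fully_invariant \<delta>" "common_identities V \<subseteq> \<delta>" "syntactic g \<subseteq> \<delta>" for \<delta>
    using assms(7)[OF that] fully_invariant.refl[OF that(1)] by simp
qed (fact assms | assumption)+

section \<open>Two-letter identities of a cancellable variety\<close>

definition two_letter_words :: "nat \<Rightarrow> nat \<Rightarrow> nat list set"
  where "two_letter_words n m = {w. set w \<subseteq> {0, 1} \<and> count_list w 0 = n \<and> count_list w 1 = m}"

lemma length_subst_word_two_letters:
  "w \<in> two_letter_words n m \<Longrightarrow> length (subst_word \<phi> w) = n * length (\<phi> 0) + m * length (\<phi> 1)"
  unfolding two_letter_words_def by (induction w arbitrary: n m) auto

lemma count_list_subst_word_two_letters: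
  "w \<in> two_letter_words n m \<Longrightarrow>
    count_list (subst_word \<phi> w) x = n * count_list (\<phi> 0) x + m * count_list (\<phi> 1) x"
  unfolding two_letter_words_def by (induction w arbitrary: n m) auto

lemma length_two_letter_words: "w \<in> two_letter_words n m \<Longrightarrow> length w = n + m"
  using length_subst_word_two_letters[of w n m "\<lambda>x. [x]"] by simp

lemma subst_word_erase_0:
  "w \<in> two_letter_words n m \<Longrightarrow> n = 0 \<or> \<phi> 0 = [] \<Longrightarrow>
    subst_word \<phi> w = concat (replicate m (\<phi> 1))"
  unfolding two_letter_words_def by (induction w arbitrary: n m) auto

lemma subst_word_erase_1:
  "w \<in> two_letter_words n m \<Longrightarrow> m = 0 \<or> \<phi> 1 = [] \<Longrightarrow>
    subst_word \<phi> w = concat (replicate n (\<phi> 0))"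
  unfolding two_letter_words_def by (induction w arbitrary: n m) auto

lemma subst_word_identify:
  "w \<in> two_letter_words n m \<Longrightarrow> \<phi> 0 = \<phi> 1 \<Longrightarrow>
    subst_word \<phi> w = concat (replicate (n + m) (\<phi> 1))"
  unfolding two_letter_words_def by (induction w arbitrary: n m) auto

lemma subst_word_two_letters_id:
  "w \<in> two_letter_words n m \<Longrightarrow> \<phi> 0 = [0] \<Longrightarrow> \<phi> 1 = [1] \<Longrightarrow> subst_word \<phi> w = w"
  unfolding two_letter_words_def by (induction w arbitrary: n m) auto

text \<open>
  A length count: a substitution that does not identify \<open>p\<close> and \<open>q\<close> erases neither letter, so it
  cannot stay within words of length \<open>n + m\<close> unless it maps letters to letters and there is no
  context.  It cannot exchange the two letters because \<open>n \<noteq> m\<close>.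
\<close>

lemma subst_word_two_letters_cases:
  assumes "p \<in> two_letter_words n m" "q \<in> two_letter_words n m" "n \<noteq> m"
    and s: "c @ subst_word \<phi> p @ d \<in> two_letter_words n m"
    and neq: "subst_word \<phi> p \<noteq> subst_word \<phi> q"
  shows "c = [] \<and> d = [] \<and> subst_word \<phi> p = p \<and> subst_word \<phi> q = q"
proof -
  have "\<phi> 0 \<noteq> []" "\<phi> 1 \<noteq> []" "\<phi> 0 \<noteq> \<phi> 1" "n > 0" "m > 0"
    using assms subst_word_erase_0 subst_word_erase_1 subst_word_identify by (metis gr0I)+
  then have "length (\<phi> 0) \<ge> 1" "length (\<phi> 1) \<ge> 1"
    by (simp_all add: Suc_leI)
  then have ge: "n * length (\<phi> 0) \<ge> n" "m * length (\<phi> 1) \<ge> m"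
    by simp_all
  have len: "length c + (n * length (\<phi> 0) + m * length (\<phi> 1)) + length d = n + m"
    using length_two_letter_words[OF s] length_subst_word_two_letters[OF assms(1)] by simp
  have "length c = 0" "length d = 0"
    and eq: "n * length (\<phi> 0) = n" "m * length (\<phi> 1) = m"
    using ge len by linarith+
  then have "c = []" "d = []" by simp_all
  have "length (\<phi> 0) = 1" "length (\<phi> 1) = 1"
    using eq \<open>n > 0\<close> \<open>m > 0\<close> by simp_all
  then obtain y z where yz: "\<phi> 0 = [y]" "\<phi> 1 = [z]"
    by (metis length_Suc_conv length_0_conv One_nat_def)
  have s': "subst_word \<phi> p \<in> two_letter_words n m"
    using s \<open>c = []\<close> \<open>d = []\<close> by simp
  have count: "count_list (subst_word \<phi> p) x = n * count_list [y] x + m * count_list [z] x" for x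
    using count_list_subst_word_two_letters[OF assms(1), of \<phi> x] yz by simp
  have "count_list (subst_word \<phi> p) y \<noteq> 0" "count_list (subst_word \<phi> p) z \<noteq> 0"
    unfolding count using \<open>n > 0\<close> \<open>m > 0\<close> by simp_all
  then have "y \<in> set (subst_word \<phi> p)" "z \<in> set (subst_word \<phi> p)"
    by (simp_all add: count_list_0_iff)
  then have "y \<in> {0, 1}" "z \<in> {0, 1}"
    using s' by (auto simp: two_letter_words_def)
  moreover have "count_list (subst_word \<phi> p) 0 = n"
    using s' by (simp add: two_letter_words_def)
  ultimately have "y = 0 \<and> z = 1"
    using count[of 0] \<open>n \<noteq> m\<close> \<open>\<phi> 0 \<noteq> \<phi> 1\<close> yz by auto
  then show ?thesis
    using assms(1,2) yz \<open>c = []\<close> \<open>d = []\<close> by (simp add: subst_word_two_letters_id)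
qed

lemma syntactic_two_letter_words:
  assumes pq: "p \<in> two_letter_words n m" "q \<in> two_letter_words n m" "n \<noteq> m" "f p = f q"
    and outside: "\<And>s. s \<notin> two_letter_words n m \<Longrightarrow> f s = z"
  shows "(p, q) \<in> syntactic f"
  unfolding syntactic_def
proof safe
  fix \<phi> c d
  show "f (c @ subst_word \<phi> p @ d) = f (c @ subst_word \<phi> q @ d)"
    using subst_word_two_letters_cases[of p n m q c \<phi> d]
      subst_word_two_letters_cases[of q n m p c \<phi> d] pq outside
    by (metis append_Nil append_Nil2)
qed

text \<open>
  Suppose \<open>V\<close> identifies \<open>u\<close> with \<open>v\<close> but not with \<open>w\<close>.  Let \<open>g\<close> isolate the three words.  The
  identities \<open>w \<approx> u\<close> and \<open>w \<approx> v\<close> are equivalent within \<open>V\<close>, and each merges only two of the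
  three labels, neither of which \<open>V\<close> merges.
\<close>

lemma cancellable_two_letter_collapse:
  fixes V :: "'a monoid set"
  assumes inf: "infinite (UNIV :: 'a set)" and V: "monoid_variety V"
    and canc: "cancellable MON_lattice V"
    and "n \<noteq> m" and W: "u \<in> two_letter_words n m" "v \<in> two_letter_words n m" "w \<in> two_letter_words n m"
    and "u \<noteq> v" and uv: "(u, v) \<in> common_identities V"
  shows "(w, u) \<in> common_identities V"
proof (rule ccontr)
  assume wu: "(w, u) \<notin> common_identities V"
  interpret \<theta>: fully_invariant "common_identities V"
    using V by (rule fully_invariant_identities)
  have wv: "(w, v) \<notin> common_identities V" "(v, w) \<notin> common_identities V" "(u, w) \<notin> common_identities V"
    using wu uv \<theta>.trans \<theta>.sym by blast+
  then have "w \<noteq> u" "w \<noteq> v" by auto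
  define g where "g p = (if p \<in> {u, v, w} then Some p else None)" for p
  define f\<^sub>1 where "f\<^sub>1 p = (if p = w then Some u else g p)" for p
  define f\<^sub>2 where "f\<^sub>2 p = (if p = w then Some v else g p)" for p
  have "(w, u) \<in> syntactic f\<^sub>1"
    using W by (intro syntactic_two_letter_words[OF _ _ \<open>n \<noteq> m\<close>, where z = None])
      (auto simp: f\<^sub>1_def g_def)
  moreover have "(w, v) \<in> syntactic f\<^sub>2"
    using W by (intro syntactic_two_letter_words[OF _ _ \<open>n \<noteq> m\<close>, where z = None])
      (auto simp: f\<^sub>2_def g_def)
  moreover have "(w, u) \<notin> syntactic f\<^sub>2"
    using syntacticD[of w u f\<^sub>2] \<open>u \<noteq> v\<close> \<open>w \<noteq> u\<close> by (auto simp: f\<^sub>2_def g_def)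
  moreover have "(w, u) \<in> \<delta> \<longleftrightarrow> (w, v) \<in> \<delta>"
    if "fully_invariant \<delta>" "common_identities V \<subseteq> \<delta>" for \<delta>
  proof -
    interpret \<delta>: fully_invariant \<delta> by fact
    have "(u, v) \<in> \<delta>" using uv that by blast
    then show ?thesis using \<delta>.trans \<delta>.sym by blast
  qed
  ultimately have "\<not> cancellable MON_lattice V"
    using wu wv
    by (intro not_cancellable_criterion[OF inf V, of g f\<^sub>1 f\<^sub>2 "(w, u)" "(w, v)"])
      (auto simp: f\<^sub>1_def f\<^sub>2_def g_def split: if_splits)
  then show False using canc by contradiction
qed

section \<open>Powers of a letter in a cancellable variety\<close>

lemma subst_word_single:
  "subst_word (\<lambda>z. if z = x then [y] else []) w = replicate (count_list w x) y"
  by (induction w) auto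

lemma hd_concat_replicate: "X \<noteq> [] \<Longrightarrow> 0 < k \<Longrightarrow> hd (concat (replicate k X)) = hd X"
  by (cases k) auto

lemma last_concat_replicate: "X \<noteq> [] \<Longrightarrow> 0 < k \<Longrightarrow> last (concat (replicate k X)) = last X"
  by (induction k) (auto simp: last_append)

lemma concat_replicate_eq_Nil [simp]: "concat (replicate k X) = [] \<longleftrightarrow> k = 0 \<or> X = []"
  by (cases k) auto

text \<open>
  In the next proof the letter \<open>0\<close> is \<open>x\<close> and \<open>1\<close> is \<open>t\<close>.  The labels must distinguish
  \<open>x\<^sup>n\<^sup>-\<^sup>1t\<^sup>mx\<close> from \<open>x\<^sup>nt\<^sup>mx\<close> while ignoring the difference between \<open>x\<^sup>nt\<^sup>m\<close> and
  \<open>x\<^sup>n\<^sup>+\<^sup>1t\<^sup>m\<close>; therefore occurrences of \<open>x\<close> are counted only in words that start and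
  end with \<open>x\<close> and contain \<open>t\<close>.
\<close>

definition guarded_by_0 :: "nat list \<Rightarrow> bool"
  where "guarded_by_0 p \<longleftrightarrow> p \<noteq> [] \<and> hd p = 0 \<and> last p = 0 \<and> 1 \<in> set p"

definition guarded_count :: "nat \<Rightarrow> nat list \<Rightarrow> nat"
  where "guarded_count k p = (if guarded_by_0 p then min k (count_list p 0) else 0)"

text \<open>
  Write \<open>w\<close> for \<open>x\<^sup>n\<^sup>-\<^sup>1t\<^sup>mx\<close> and \<open>u\<close> for \<open>x\<^sup>nt\<^sup>mx\<close>.  Counting \<open>x\<close> up to \<open>n\<close> does not
  separate \<open>w\<close> from \<open>u\<close>, counting up to \<open>n + 1\<close> does.  The two counts differ only between \<open>n\<close>
  and larger numbers of occurrences, which \<open>V\<close> separates if no \<open>x\<^sup>n \<approx> x\<^sup>n\<^sup>+\<^sup>k\<close> holds in it.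
  Within \<open>V\<close>, however, \<open>x\<close> can be moved through \<open>t\<^sup>m\<close>, and then \<open>w \<approx> u\<close> follows from
  \<open>x\<^sup>nt\<^sup>m \<approx> x\<^sup>n\<^sup>+\<^sup>1t\<^sup>m\<close>, which respects the finer count.
\<close>

lemma cancellable_imp_periodic_at:
  fixes V :: "'a monoid set"
  assumes inf: "infinite (UNIV :: 'a set)" and V: "monoid_variety V"
    and canc: "cancellable MON_lattice V"
    and n: "n \<ge> 2" and m: "m \<ge> 1"
    and move: "(replicate (n - 1) 0 @ replicate m 1 @ [0], replicate n 0 @ replicate m 1) \<in> common_identities V"
  shows "\<exists>k\<ge>1. (replicate n 0, replicate (n + k) 0) \<in> common_identities V"
proof (rule ccontr)
  assume no: "\<not> ?thesis"
  interpret \<theta>: fully_invariant "common_identities V"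
    using V by (rule fully_invariant_identities)
  have sep: "guarded_count (n + 1) p = guarded_count (n + 1) q"
    if pq: "(p, q) \<in> common_identities V" and eq: "guarded_count n p = guarded_count n q" for p q
  proof -
    have pos: "count_list r 0 > 0" if "guarded_by_0 r" for r
      using that by (cases r) (auto simp: guarded_by_0_def)
    have "(replicate (count_list p 0) 0, replicate (count_list q 0) 0) \<in> common_identities V"
      using \<theta>.subst[OF pq, of "\<lambda>z. if z = 0 then [0] else []"] by (simp only: subst_word_single)
    then have "\<not> (count_list p 0 = n \<and> n < count_list q 0)" "\<not> (count_list q 0 = n \<and> n < count_list p 0)"
      using no \<theta>.sym less_imp_add_positive by (metis One_nat_def Suc_leI)+
    then show ?thesis
      using eq pos[of p] pos[of q] n by (auto simp: guarded_count_def min_def split: if_splits)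
  qed
  define w where "w = replicate (n - 1) 0 @ replicate m (1::nat) @ [0::nat]"
  define u where "u = replicate n 0 @ replicate m (1::nat) @ [0::nat]"
  have wu: "(w, u) \<in> syntactic (guarded_count n)"
    unfolding syntactic_def
  proof safe
    fix \<phi> :: "nat \<Rightarrow> nat list" and c d
    define X where "X = \<phi> 0"
    define T where "T = \<phi> 1"
    define A where "A = c @ (concat (replicate (n - 1) X) @ concat (replicate m T) @ X) @ d"
    define B where "B = c @ (concat (replicate n X) @ concat (replicate m T) @ X) @ d"
    have "guarded_count n A = guarded_count n B"
    proof (cases "X = []")
      case False
      have "guarded_by_0 A \<longleftrightarrow> guarded_by_0 B"
        using False n by (auto simp: guarded_by_0_def A_def B_def hd_append last_append hd_concat_replicate)
      moreover have "min n (count_list A 0) = min n (count_list B 0)"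
      proof (cases "count_list X 0 = 0")
        case False
        then have "(n - 1) * count_list X 0 \<ge> (n - 1) * 1"
          by (intro mult_le_mono2) simp
        moreover have "n * count_list X 0 = (n - 1) * count_list X 0 + count_list X 0"
          using n by (simp add: mult_eq_if)
        moreover have "count_list A 0 \<ge> (n - 1) * count_list X 0 + count_list X 0"
          "count_list B 0 \<ge> n * count_list X 0 + count_list X 0"
          by (simp_all add: A_def B_def)
        ultimately have "count_list A 0 \<ge> n" "count_list B 0 \<ge> n"
          using False by linarith+
        then show ?thesis by simp
      qed (simp add: A_def B_def)
      ultimately show ?thesis by (simp add: guarded_count_def)
    qed (simp add: A_def B_def)
    then show "guarded_count n (c @ subst_word \<phi> w @ d) = guarded_count n (c @ subst_word \<phi> u @ d)"
      by (simp add: w_def u_def A_def B_def X_def T_def)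
  qed
  have "guarded_count (n + 1) w \<noteq> guarded_count (n + 1) u"
    using n m by (auto simp: guarded_count_def guarded_by_0_def w_def u_def hd_append count_list_0_iff)
  then have not_wu: "(w, u) \<notin> syntactic (guarded_count (n + 1))"
    using syntacticD by blast
  have pump: "(replicate n 0 @ replicate m 1, replicate (n + 1) 0 @ replicate m 1)
      \<in> syntactic (guarded_count (n + 1))"
    unfolding syntactic_def
  proof safe
    fix \<phi> :: "nat \<Rightarrow> nat list" and c d
    define X where "X = \<phi> 0"
    define T where "T = \<phi> 1"
    define A where "A = c @ (concat (replicate n X) @ concat (replicate m T)) @ d"
    define B where "B = c @ (concat (replicate (n + 1) X) @ concat (replicate m T)) @ d"
    have "guarded_count (n + 1) A = guarded_count (n + 1) B"
    proof (cases "X = []")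
      case False
      have gAB: "guarded_by_0 A \<longleftrightarrow> guarded_by_0 B"
        using False n m by (auto simp: guarded_by_0_def A_def B_def hd_append last_append
            hd_concat_replicate last_concat_replicate simp del: replicate_Suc)
      have "min (n + 1) (count_list A 0) = min (n + 1) (count_list B 0)" if g: "guarded_by_0 A"
      proof -
        define rest where "rest = count_list c 0 + m * count_list T 0 + count_list d 0"
        have cA: "count_list A 0 = n * count_list X 0 + rest"
          and cB: "count_list B 0 = n * count_list X 0 + count_list X 0 + rest"
          by (simp_all add: A_def B_def rest_def)
        consider "count_list X 0 = 0" | "count_list X 0 = 1" "rest = 0"
          | "count_list X 0 = 1" "rest \<ge> 1" | "count_list X 0 \<ge> 2"
          by linarith
        then show ?thesis
        proof cases
          \<comment> \<open>Only here do the two truncated counts differ, namely \<open>n\<close> and \<open>n + 1\<close>; a guarded word would then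
            consist of copies of \<open>X = [0]\<close> alone and miss the letter \<open>1\<close>.\<close>
          case 2
          then have "0 \<notin> set c" "0 \<notin> set d" "0 \<notin> set T"
            using m by (simp_all add: rest_def count_list_0_iff)
          moreover have "c = [] \<or> hd c = 0"
            using g by (cases c) (simp_all add: guarded_by_0_def A_def)
          moreover have "d = [] \<or> last d = 0"
            using g by (cases d rule: rev_cases) (simp_all add: guarded_by_0_def A_def)
          ultimately have "c = []" "d = []"
            using hd_in_set last_in_set by metis+
          have "last A = last T" if "T \<noteq> []"
            using that \<open>d = []\<close> m by (simp add: A_def last_concat_replicate)
          then have "T = []"
            using g \<open>0 \<notin> set T\<close> last_in_set[of T] unfolding guarded_by_0_def by metis
          then have A: "A = concat (replicate n X)"
            using \<open>c = []\<close> \<open>d = []\<close> by (simp add: A_def)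
          then have "hd X = 0" "last X = 0"
            using g n False by (simp_all add: guarded_by_0_def hd_concat_replicate last_concat_replicate)
          moreover obtain y X' where X: "X = y # X'"
            using False by (cases X) auto
          moreover have "last X = last X'" if "X' \<noteq> []" using that X by simp
          ultimately have "0 \<notin> set X'" "X' \<noteq> [] \<Longrightarrow> last X' = 0"
            using 2(1) by (auto simp: count_list_0_iff split: if_splits)
          then have "X' = []" using last_in_set by metis
          then have "set A \<subseteq> {0}"
            using A X \<open>hd X = 0\<close> by (simp add: set_replicate_conv_if)
          then show ?thesis using g by (auto simp: guarded_by_0_def)
        next
          case 4
          then have "n * count_list X 0 \<ge> n * 2" by (rule mult_le_mono2)
          then have "count_list A 0 \<ge> n + 1" "count_list B 0 \<ge> n + 1"
            using cA cB n by linarith+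
          then show ?thesis by simp
        qed (simp_all add: cA cB)
      qed
      then show ?thesis using gAB by (simp add: guarded_count_def)
    qed (simp add: A_def B_def)
    then show "guarded_count (n + 1) (c @ subst_word \<phi> (replicate n 0 @ replicate m 1) @ d) =
        guarded_count (n + 1) (c @ subst_word \<phi> (replicate (n + 1) 0 @ replicate m 1) @ d)"
      by (simp add: A_def B_def X_def T_def)
  qed
  have "\<not> cancellable MON_lattice V"
  proof (rule not_cancellable_refinement[of V "guarded_count (n + 1)" "guarded_count n" "(w, u)"])
    show "guarded_count n p = guarded_count n q"
      if "guarded_count (n + 1) p = guarded_count (n + 1) q" for p q
    proof -
      have "guarded_count n r = min n (guarded_count (n + 1) r)" for r
        by (auto simp: guarded_count_def min_def)
      then show ?thesis using that by simp
    qed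
    show "(w, u) \<in> \<delta>" if "fully_invariant \<delta>" "common_identities V \<subseteq> \<delta>"
      "syntactic (guarded_count (n + 1)) \<subseteq> \<delta>" for \<delta>
    proof -
      interpret \<delta>: fully_invariant \<delta> by fact
      have *: "(w, replicate n 0 @ replicate m 1) \<in> \<delta>"
        using move that(2) unfolding w_def by blast
      also have "(replicate n 0 @ replicate m 1, replicate (n + 1) 0 @ replicate m 1) \<in> \<delta>"
        using pump that(3) by blast
      also have "(replicate (n + 1) 0 @ replicate m 1, u) \<in> \<delta>"
      proof -
        obtain n' where n': "n = Suc n'" using n by (cases n) auto
        show ?thesis using \<delta>.sym[OF \<delta>.cong_left[OF *, of "[0]"]] by (simp add: w_def u_def n')
      qed
      finally show ?thesis .
    qed
  qed (fact inf V wu not_wu sep)+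
  then show False using canc by contradiction
qed

lemma split_at_unique_letter:
  assumes "A @ t # B = replicate i x @ t # replicate j x" "t \<noteq> x"
  shows "A = replicate i x \<and> B = replicate j x"
proof -
  have "count_list (A @ t # B) t = 1"
    unfolding assms(1) using assms(2) by (simp add: count_list_0_iff)
  then have "t \<notin> set A" "t \<notin> set B" by (simp_all add: count_list_0_iff)
  then show ?thesis
    using assms(1) by (simp add: append_Cons_eq_iff)
qed

text \<open>
  The pattern \<open>X\<^sup>aTX\<^sup>b\<close> inside \<open>x\<^sup>itx\<^sup>j\<close>: as \<open>a + b \<ge> 2\<close>, the single \<open>t\<close> is not in \<open>X\<close>.
  It is not outside the pattern either, for then the \<open>a + b\<close> copies of \<open>X\<close> would fit into one
  block of \<open>x\<close>.  So \<open>T\<close> contains \<open>t\<close>, and the copies of \<open>X\<close> lie in the two blocks.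
\<close>

lemma isolated_factor:
  assumes eq: "C @ concat (replicate a X) @ T @ concat (replicate b X) @ D = replicate i x @ t # replicate j x"
    and "t \<noteq> x" "X \<noteq> []" "a \<ge> 1" "b \<ge> 1" and ij: "i < a + b" "j < a + b"
  shows "a \<le> i" "b \<le> j" "i = a \<Longrightarrow> j = b \<Longrightarrow> C = [] \<and> D = [] \<and> T = [t] \<and> X = [x]"
proof -
  let ?A = "concat (replicate a X)" and ?B = "concat (replicate b X)"
  have "length X \<ge> 1" using \<open>X \<noteq> []\<close> by (simp add: Suc_leI)
  then have len: "a * length X \<ge> a" "b * length X \<ge> b" by simp_all
  have "count_list (C @ ?A @ T @ ?B @ D) t = 1"
    unfolding eq using \<open>t \<noteq> x\<close> by (simp add: count_list_0_iff)
  then have "count_list C t + a * count_list X t + count_list T t + b * count_list X t + count_list D t = 1"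
    by simp
  moreover have "a * count_list X t \<ge> count_list X t" "b * count_list X t \<ge> count_list X t"
    using \<open>a \<ge> 1\<close> \<open>b \<ge> 1\<close> by simp_all
  ultimately have "count_list X t = 0" by linarith
  then have "t \<notin> set ?A" "t \<notin> set ?B" by (simp_all add: count_list_0_iff)
  moreover have "t \<in> set (C @ ?A @ T @ ?B @ D)" unfolding eq by simp
  ultimately consider "t \<in> set C" | "t \<in> set D" | "t \<in> set T" by auto
  then have "a \<le> i \<and> b \<le> j \<and> (i = a \<and> j = b \<longrightarrow> C = [] \<and> D = [] \<and> T = [t] \<and> X = [x])"
  proof cases
    case 1
    then obtain C1 C2 where C: "C = C1 @ t # C2" by (meson split_list)
    have "C2 @ ?A @ T @ ?B @ D = replicate j x"
      using split_at_unique_letter[of C1 t "C2 @ ?A @ T @ ?B @ D" i x j] eq \<open>t \<noteq> x\<close> by (simp add: C)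
    then have "length (C2 @ ?A @ T @ ?B @ D) = j" by (metis length_replicate)
    then show ?thesis using len ij by simp
  next
    case 2
    then obtain D1 D2 where D: "D = D1 @ t # D2" by (meson split_list)
    have "C @ ?A @ T @ ?B @ D1 = replicate i x"
      using split_at_unique_letter[of "C @ ?A @ T @ ?B @ D1" t D2 i x j] eq \<open>t \<noteq> x\<close> by (simp add: D)
    then have "length (C @ ?A @ T @ ?B @ D1) = i" by (metis length_replicate)
    then show ?thesis using len ij by simp
  next
    case 3
    then obtain T1 T2 where T: "T = T1 @ t # T2" by (meson split_list)
    have AB: "C @ ?A @ T1 = replicate i x" "T2 @ ?B @ D = replicate j x"
      using split_at_unique_letter[of "C @ ?A @ T1" t "T2 @ ?B @ D" i x j] eq \<open>t \<noteq> x\<close>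
      by (simp_all add: T)
    then have l: "length (C @ ?A @ T1) = i" "length (T2 @ ?B @ D) = j"
      by (metis length_replicate)+
    then have "length C + a * length X + length T1 = i" "length T2 + b * length X + length D = j"
      by simp_all
    then have "a \<le> i" "b \<le> j" using len by linarith+
    moreover have "C = [] \<and> D = [] \<and> T = [t] \<and> X = [x]" if "i = a" "j = b"
    proof -
      have "length C + a * length X + length T1 = a" "length T2 + b * length X + length D = b"
        using l that by simp_all
      then have "length C = 0" "length D = 0" "length T1 = 0" "length T2 = 0" "a * length X = a"
        using len by linarith+
      then have "C = []" "D = []" "T = [t]" "length X = 1"
        using \<open>a \<ge> 1\<close> T by simp_all
      moreover have "set X \<subseteq> set (C @ ?A @ T1)"
        using \<open>a \<ge> 1\<close> by auto
      then have "set X \<subseteq> {x}"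
        unfolding AB(1) by (auto split: if_splits)
      moreover obtain y where "X = [y]" using \<open>length X = 1\<close> by (auto simp: length_Suc_conv)
      ultimately show ?thesis by simp
    qed
    ultimately show ?thesis by blast
  qed
  then show "a \<le> i" "b \<le> j" "i = a \<Longrightarrow> j = b \<Longrightarrow> C = [] \<and> D = [] \<and> T = [t] \<and> X = [x]"
    by blast+
qed

text \<open>
  Take \<open>w = x\<^sup>s\<^sup>+\<^sup>1tx\<^sup>s\<^sup>+\<^sup>3\<close> and \<open>u = x\<^sup>s\<^sup>+\<^sup>3tx\<^sup>s\<^sup>+\<^sup>2\<close>, and let the labels isolate
  both words.  The exponent pairs \<open>(s + 1, s + 3)\<close> and \<open>(s + 3, s + 2)\<close> are incomparable, so by
  \<open>isolated_factor\<close> the identity \<open>w \<approx> u\<close> applies to \<open>w\<close> and \<open>u\<close> only trivially.  Long powers of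
  \<open>x\<close> carry no label, so \<open>Z\<close> satisfies some \<open>x\<^sup>N \<approx> x\<^sup>N\<^sup>+\<^sup>1\<close>; with
  \<open>x\<^sup>s \<approx> x\<^sup>s\<^sup>+\<^sup>k\<close> this gives \<open>x\<^sup>s \<approx> x\<^sup>s\<^sup>+\<^sup>1\<close> in \<open>V \<and> Z\<close>, hence \<open>w \<approx> u\<close>.  So a
  cancellable \<open>V\<close> satisfies \<open>w \<approx> u\<close>, and erasing \<open>t\<close> leaves powers whose exponents
  \<open>2s + 4\<close> and \<open>2s + 5\<close> differ by one.
\<close>

lemma cancellable_periodic_imp_aperiodic:
  fixes V :: "'a monoid set"
  assumes inf: "infinite (UNIV :: 'a set)" and V: "monoid_variety V"
    and canc: "cancellable MON_lattice V"
    and k: "k \<ge> 1" and per: "(replicate s 0, replicate (s + k) 0) \<in> common_identities V"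
  shows "\<exists>r. (replicate r 0, replicate (r + 1) 0) \<in> common_identities V"
proof -
  interpret \<theta>: fully_invariant "common_identities V"
    using V by (rule fully_invariant_identities)
  define w where "w = replicate (s + 1) 0 @ (1::nat) # replicate (s + 3) (0::nat)"
  define u where "u = replicate (s + 3) 0 @ (1::nat) # replicate (s + 2) (0::nat)"
  have "length w \<noteq> length u" by (simp add: w_def u_def)
  then have "w \<noteq> u" by blast
  define g where "g p = (if p = w then 1 else if p = u then 2 else (0::nat))" for p
  define f where "f p = (if p = w \<or> p = u then 1 else (0::nat))" for p
  have wu: "(w, u) \<in> syntactic f"
    unfolding syntactic_def
  proof safe
    fix \<phi> :: "nat \<Rightarrow> nat list" and c d
    define X where "X = \<phi> 0"
    define T where "T = \<phi> 1"
    define A where "A = c @ concat (replicate (s + 1) X) @ T @ concat (replicate (s + 3) X) @ d"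
    define B where "B = c @ concat (replicate (s + 3) X) @ T @ concat (replicate (s + 2) X) @ d"
    have "f A = f B"
    proof (cases "X = []")
      case False
      have trivial: "A = w \<and> B = u" if "c = [] \<and> d = [] \<and> T = [1] \<and> X = [0]"
        using that by (simp add: A_def B_def w_def u_def)
      have "A = w \<and> B = u" if "A = w \<or> A = u"
        using that
      proof
        assume "A = w"
        then show ?thesis
          using isolated_factor(3)[of c "s + 1" X T "s + 3" d "s + 1" 0 1 "s + 3"] False trivial
          by (simp only: A_def w_def) simp
      next
        assume "A = u"
        then show ?thesis
          using isolated_factor(2)[of c "s + 1" X T "s + 3" d "s + 3" 0 1 "s + 2"] False
          by (simp only: A_def u_def) simp
      qed
      moreover have "A = w \<and> B = u" if "B = w \<or> B = u"
        using that
      proof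
        assume "B = w"
        then show ?thesis
          using isolated_factor(1)[of c "s + 3" X T "s + 2" d "s + 1" 0 1 "s + 3"] False
          by (simp only: B_def w_def) simp
      next
        assume "B = u"
        then show ?thesis
          using isolated_factor(3)[of c "s + 3" X T "s + 2" d "s + 3" 0 1 "s + 2"] False trivial
          by (simp only: B_def u_def) simp
      qed
      ultimately show ?thesis unfolding f_def by metis
    qed (simp add: A_def B_def)
    then show "f (c @ subst_word \<phi> w @ d) = f (c @ subst_word \<phi> u @ d)"
      by (simp only: w_def u_def A_def B_def X_def T_def subst_word_simps append_assoc)
  qed
  have not_wu: "(w, u) \<notin> syntactic g"
    using syntacticD[of w u g] \<open>w \<noteq> u\<close> by (auto simp: g_def)
  \<comment> \<open>more than the lengths \<open>2s + 5\<close> and \<open>2s + 6\<close> of \<open>w\<close> and \<open>u\<close>\<close>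
  define N where "N = 2 * s + 7"
  have absorb: "(replicate N 0, replicate (N + 1) 0) \<in> syntactic g"
    unfolding syntactic_def
  proof safe
    fix \<phi> :: "nat \<Rightarrow> nat list" and c d
    show "g (c @ subst_word \<phi> (replicate N 0) @ d) = g (c @ subst_word \<phi> (replicate (N + 1) 0) @ d)"
    proof (cases "\<phi> 0 = []")
      case True
      then show ?thesis by simp
    next
      case False
      have long: "c @ subst_word \<phi> (replicate M 0) @ d \<noteq> r" if "M \<ge> N" "r \<in> {w, u}" for M r
      proof -
        have "M * length (\<phi> 0) \<ge> M * 1"
          using False by (intro mult_le_mono2) (simp add: Suc_leI)
        moreover have "length (c @ subst_word \<phi> (replicate M 0) @ d) \<ge> M * length (\<phi> 0)"
          by simp
        moreover have "length r < N"
          using that by (auto simp: w_def u_def N_def)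
        ultimately have "length (c @ subst_word \<phi> (replicate M 0) @ d) > length r"
          using that by linarith
        then show ?thesis by blast
      qed
      have "g (c @ subst_word \<phi> (replicate M 0) @ d) = 0" if "M \<ge> N" for M
        unfolding g_def using long[OF that] by (metis insertI1 insertI2)
      then show ?thesis by (metis order_refl le_add1)
    qed
  qed
  have "(w, u) \<in> common_identities V"
  proof (rule ccontr)
    assume nwu: "(w, u) \<notin> common_identities V"
    have "\<not> cancellable MON_lattice V"
    proof (rule not_cancellable_refinement[of V g f "(w, u)"])
      show "f p = f q" if "g p = g q" for p q
        using that by (auto simp: f_def g_def split: if_splits)
      show "g p = g q" if "(p, q) \<in> common_identities V" "f p = f q" for p q
        using that nwu \<theta>.sym by (auto simp: f_def g_def split: if_splits)
      show "(w, u) \<in> \<delta>" if "fully_invariant \<delta>" "common_identities V \<subseteq> \<delta>" "syntactic g \<subseteq> \<delta>" for \<delta>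
      proof -
        interpret \<delta>: fully_invariant \<delta> by fact
        have step: "(replicate s (0::nat), replicate (s + l * k) 0) \<in> \<delta>" for l
        proof (induction l)
          case (Suc l)
          have "(replicate (s + l * k) (0::nat), replicate (s + Suc l * k) 0) \<in> \<delta>"
            using \<delta>.cong_left[of "replicate s 0" "replicate (s + k) 0" "replicate (l * k) 0"] per that(2)
            by (auto simp: replicate_add[symmetric] algebra_simps)
          then show ?case using Suc \<delta>.trans by blast
        qed simp
        have "(replicate (N + r) (0::nat), replicate (N + r + 1) 0) \<in> \<delta>" for r
          using \<delta>.cong_left[of "replicate N 0" "replicate (N + 1) 0" "replicate r 0"] absorb that(3)
          by (auto simp only: replicate_add[symmetric] add.commute add.left_commute subset_iff)
        moreover obtain r where "s + N * k = N + r"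
        proof -
          have "N * k \<ge> N" using k by simp
          then have "N \<le> s + N * k" by linarith
          then show ?thesis using that le_Suc_ex by blast
        qed
        ultimately have "(replicate (s + N * k) (0::nat), replicate (s + N * k + 1) 0) \<in> \<delta>"
          by simp
        moreover have "(replicate (s + 1) (0::nat), replicate (s + N * k + 1) 0) \<in> \<delta>"
          using \<delta>.cong_left[OF step[of N], of "[0]"] by simp
        ultimately have one: "(replicate s (0::nat), replicate (s + 1) 0) \<in> \<delta>"
          using step \<delta>.trans \<delta>.sym by blast
        have up: "(replicate s (0::nat), replicate (s + l) 0) \<in> \<delta>" for l
          using \<delta>.replicate_absorb[OF one] by simp
        have "(replicate (s + i) (0::nat) @ 1 # replicate (s + j) 0, replicate s 0 @ 1 # replicate s 0) \<in> \<delta>" for i j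
          using \<delta>.append[OF up[of i] \<delta>.append[OF \<delta>.refl up[of j]], of "[1]"] \<delta>.sym by simp
        then show ?thesis unfolding w_def u_def using \<delta>.trans \<delta>.sym by blast
      qed
    qed (fact inf V wu not_wu)+
    then show False using canc by contradiction
  qed
  then have "(subst_word (\<lambda>z. if z = 0 then [0] else []) w, subst_word (\<lambda>z. if z = 0 then [0] else []) u)
      \<in> common_identities V" (is "(?w, ?u) \<in> _")
    by (rule \<theta>.subst)
  moreover have "?w = replicate (2 * s + 4) 0" "?u = replicate (2 * s + 4 + 1) 0"
    unfolding subst_word_single by (simp_all add: w_def u_def numeral_eq_Suc)
  ultimately have "(replicate (2 * s + 4) 0, replicate (2 * s + 4 + 1) 0) \<in> common_identities V"
    by (simp only:)
  then show ?thesis by blast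
qed

section \<open>Identities of the four small varieties\<close>

definition occ2 :: "nat list \<Rightarrow> nat \<Rightarrow> nat"
  where "occ2 p = (\<lambda>x. min 2 (count_list p x))"

definition simple_part :: "nat list \<Rightarrow> nat list"
  where "simple_part p = filter (\<lambda>x. count_list p x = 1) p"

lemma count_list_filter [simp]: "count_list (filter P p) x = (if P x then count_list p x else 0)"
  by (induction p) auto

lemma count_list_removeAll [simp]: "count_list (removeAll y p) x = (if x = y then 0 else count_list p x)"
  by (induction p) auto

lemma distinct_if_count_list_le_1: "(\<And>x. count_list p x \<le> 1) \<Longrightarrow> distinct p"
proof (induction p)
  case (Cons a p)
  have "count_list p x \<le> 1" for x using Cons.prems[of x] by (simp split: if_splits)
  moreover have "a \<notin> set p" using Cons.prems[of a] by (simp add: count_list_0_iff)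
  ultimately show ?case using Cons.IH by simp
qed simp

lemma occ2_set: "occ2 p = occ2 q \<Longrightarrow> set p = set q"
proof -
  assume "occ2 p = occ2 q"
  then have "count_list p x = 0 \<longleftrightarrow> count_list q x = 0" for x
    unfolding occ2_def fun_eq_iff by (auto dest!: spec[of _ x] simp: min_def split: if_splits)
  then show ?thesis by (auto simp: count_list_0_iff)
qed

lemma occ2_count_1: "occ2 p = occ2 q \<Longrightarrow> count_list p x = 1 \<longleftrightarrow> count_list q x = 1"
  unfolding occ2_def fun_eq_iff by (auto dest!: spec[of _ x] simp: min_def split: if_splits)

lemma occ2_all_multiple:
  assumes "set p = set q" "\<And>x. x \<in> set p \<Longrightarrow> 2 \<le> count_list p x" "\<And>x. x \<in> set p \<Longrightarrow> 2 \<le> count_list q x"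
  shows "occ2 p = occ2 q" "simple_part p = simple_part q"
proof -
  have "min 2 (count_list p x) = min 2 (count_list q x)" for x
    using assms by (cases "x \<in> set p") auto
  then show "occ2 p = occ2 q" by (simp add: occ2_def)
  show "simple_part p = simple_part q"
  proof -
    have "simple_part r = []" if "\<And>x. x \<in> set r \<Longrightarrow> 2 \<le> count_list r x" for r
    proof -
      have "count_list r x \<noteq> 1" if "x \<in> set r" for x
        using \<open>\<And>x. x \<in> set r \<Longrightarrow> 2 \<le> count_list r x\<close>[OF that] by linarith
      then show ?thesis by (simp add: simple_part_def)
    qed
    then show ?thesis using assms by metis
  qed
qed

lemma split_at_two_occurrences:
  assumes "2 \<le> count_list p x"
  obtains a b c where "p = a @ x # b @ x # c"
proof -
  have "x \<in> set p" using assms by (metis count_notin not_numeral_le_zero)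
  then obtain a r where p: "p = a @ x # r" "x \<notin> set a" by (meson split_list_first)
  then have "x \<in> set r" using assms by (metis count_list.simps(2) count_list_append count_notin
    Suc_1 add_0 Suc_eq_plus1 not_less_eq_eq zero_less_one le_numeral_extra(3))
  then obtain b c where "r = b @ x # c" by (meson split_list)
  then show ?thesis using that p by blast
qed

context fully_invariant
begin

text \<open>
  The three identities that define \<open>D\<close> allow all occurrences of a letter that occurs at least
  twice to be collected into a square at the front; what remains is the word of the letters
  occurring once, in their order.  So \<open>D\<close> knows a word by \<open>occ2\<close> and \<open>simple_part\<close>.
\<close>

lemma squares_central:
  assumes D: "([0,0], [0,0,0]) \<in> \<alpha>" "([0,0,1], [0,1,0]) \<in> \<alpha>" "([0,1,0], [1,0,0]) \<in> \<alpha>"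
  shows "(x # v @ [x], [x, x] @ v) \<in> \<alpha>" "([x, x] @ v, v @ [x, x]) \<in> \<alpha>" "([x, x, x], [x, x]) \<in> \<alpha>"
proof -
  let ?\<phi> = "\<lambda>z. if z = 0 then [x] else v"
  have "([x, x] @ v, x # v @ [x]) \<in> \<alpha>" "(x # v @ [x], v @ [x, x]) \<in> \<alpha>" "([x, x], [x, x, x]) \<in> \<alpha>"
    using subst[OF D(1), of ?\<phi>] subst[OF D(2), of ?\<phi>] subst[OF D(3), of ?\<phi>] by simp_all
  then show "(x # v @ [x], [x, x] @ v) \<in> \<alpha>" "([x, x] @ v, v @ [x, x]) \<in> \<alpha>" "([x, x, x], [x, x]) \<in> \<alpha>"
    using sym trans by blast+
qed

lemma gather_multiple_letter:
  assumes D: "([0,0], [0,0,0]) \<in> \<alpha>" "([0,0,1], [0,1,0]) \<in> \<alpha>" "([0,1,0], [1,0,0]) \<in> \<alpha>"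
    and "2 \<le> count_list p x"
  shows "(p, [x, x] @ removeAll x p) \<in> \<alpha>"
proof -
  note sq = squares_central[OF D]
  obtain a b c where p: "p = a @ x # b @ x # c"
    using assms(4) by (rule split_at_two_occurrences)
  have "(p, (a @ [x, x]) @ b @ c) \<in> \<alpha>"
    using cong[OF sq(1)[of x b], of a c] by (simp add: p)
  moreover have "((a @ [x, x]) @ b @ c, ([x, x] @ a) @ b @ c) \<in> \<alpha>"
    using sym[OF sq(2)] by (rule cong_right)
  ultimately have "(p, ([x, x] @ a) @ b @ c) \<in> \<alpha>"
    by (rule trans)
  moreover have "([x, x] @ q, [x, x] @ removeAll x q) \<in> \<alpha>" for q
  proof (induction q)
    case (Cons y q)
    show ?case
    proof (cases "y = x")
      case True
      then show ?thesis using trans[OF cong_right[OF sq(3), of x q] Cons] by simp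
    next
      case False
      have "([x, x] @ [y] @ q, [y] @ [x, x] @ q) \<in> \<alpha>"
        using cong_right[OF sq(2)[of x "[y]"], of q] by simp
      moreover have "([y] @ [x, x] @ q, [y] @ [x, x] @ removeAll x q) \<in> \<alpha>"
        using Cons by (rule cong_left)
      moreover have "([y] @ [x, x] @ removeAll x q, [x, x] @ [y] @ removeAll x q) \<in> \<alpha>"
        using cong_right[OF sym[OF sq(2)[of x "[y]"]], of "removeAll x q"] by simp
      ultimately have "([x, x] @ [y] @ q, [x, x] @ [y] @ removeAll x q) \<in> \<alpha>"
        using trans by blast
      then show ?thesis using False by simp
    qed
  qed simp
  then have "(([x, x] @ a) @ b @ c, [x, x] @ removeAll x p) \<in> \<alpha>"
    by (metis p append_assoc removeAll.simps(2) removeAll_append)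
  ultimately show ?thesis by (rule trans)
qed

lemma D_derivable:
  assumes D: "([0,0], [0,0,0]) \<in> \<alpha>" "([0,0,1], [0,1,0]) \<in> \<alpha>" "([0,1,0], [1,0,0]) \<in> \<alpha>"
    and "occ2 p = occ2 q" "simple_part p = simple_part q"
  shows "(p, q) \<in> \<alpha>"
  using assms(4,5)
proof (induction "length p" arbitrary: p q rule: less_induct)
  case less
  show ?case
  proof (cases "\<exists>x. 2 \<le> count_list p x")
    case True
    then obtain x where x: "2 \<le> count_list p x" by blast
    then have x': "2 \<le> count_list q x"
      using less.prems(1) by (auto simp: occ2_def fun_eq_iff dest!: spec[of _ x])
    have simple: "simple_part (removeAll x r) = simple_part r" if "2 \<le> count_list r x" for r
      using that by (auto simp: simple_part_def removeAll_filter_not_eq intro!: filter_cong)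
    have "x \<in> set p" using x by (metis count_notin not_numeral_le_zero)
    then have "length (removeAll x p) < length p" by (rule length_removeAll_less)
    moreover have "occ2 (removeAll x p) = occ2 (removeAll x q)"
      using less.prems(1) by (auto simp: occ2_def fun_eq_iff)
    ultimately have "(removeAll x p, removeAll x q) \<in> \<alpha>"
      using less.hyps less.prems(2) simple x x' by simp
    then show ?thesis
      using gather_multiple_letter[OF D x] gather_multiple_letter[OF D x'] cong_left sym trans by blast
  next
    case False
    have "simple_part r = r" if "\<And>x. \<not> 2 \<le> count_list r x" for r
    proof -
      have "count_list r x = 1" if "x \<in> set r" for x
        using that \<open>\<And>x. \<not> 2 \<le> count_list r x\<close>[of x] count_list_0_iff[of r x] by linarith
      then show ?thesis by (simp add: simple_part_def)
    qed
    moreover have "\<not> 2 \<le> count_list q x" for x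
      using False less.prems(1) by (auto simp: occ2_def fun_eq_iff dest!: spec[of _ x])
    ultimately have "p = q" using False less.prems(2) by metis
    then show ?thesis by simp
  qed
qed

lemma sort_derivable:
  assumes "([0,1], [1,0]) \<in> \<alpha>"
  shows "(p, sort p) \<in> \<alpha>"
proof -
  have comm: "([x, y], [y, x]) \<in> \<alpha>" for x y
    using subst[OF assms, of "\<lambda>z. if z = 0 then [x] else [y]"] by simp
  have ins: "(x # r, insort x r) \<in> \<alpha>" for x r
  proof (induction r)
    case (Cons y r)
    have "([x, y] @ r, [y, x] @ r) \<in> \<alpha>" using comm by (rule cong_right)
    moreover have "([y] @ x # r, [y] @ insort x r) \<in> \<alpha>" using Cons by (rule cong_left)
    ultimately show ?case using trans by auto
  qed simp
  show ?thesis
  proof (induction p)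
    case (Cons x p)
    then have "(x # p, x # sort p) \<in> \<alpha>" using cong_left[of p "sort p" "[x]"] by simp
    then show ?case using trans[OF _ ins] by simp
  qed simp
qed

end

lemma count_list_sort [simp]: "count_list (sort p) x = count_list p (x::nat)"
proof -
  have "count_list (insort y r) x = count_list (y # r) x" for y and r :: "nat list"
    by (induction r) auto
  then show ?thesis by (induction p) auto
qed

lemma occ2_sort:
  assumes "occ2 p = occ2 q"
  shows "occ2 (sort p) = occ2 (sort q)" "simple_part (sort p) = simple_part (sort q)"
proof -
  show "occ2 (sort p) = occ2 (sort q)" using assms by (simp add: occ2_def)
  have mem: "x \<in> set r" if "count_list r x = Suc 0" for r and x :: nat
    using that by (metis count_notin nat.distinct(1))
  have "sorted (simple_part (sort r))" "distinct (simple_part (sort r))"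
    "set (simple_part (sort r)) = {x. count_list r x = 1}" for r
    unfolding simple_part_def
    by (auto intro!: sorted_filter[where f = "\<lambda>x. x", simplified] distinct_if_count_list_le_1
        simp: count_list_0_iff[symmetric] intro: mem)
  moreover from this have "set (simple_part (sort p)) = set (simple_part (sort q))"
    using occ2_count_1[OF assms] by simp
  ultimately show "simple_part (sort p) = simple_part (sort q)"
    by (intro sorted_distinct_set_unique)
qed

lemma D_satisfies:
  assumes "occ2 p = occ2 q" "simple_part p = simple_part q"
  shows "(p, q) \<in> common_identities (D_var :: 'a monoid set)"
proof -
  interpret fully_invariant "common_identities (D_var :: 'a monoid set)"
    by (intro fully_invariant_identities monoid_variety_five)
  show ?thesis
    by (rule D_derivable[OF _ _ _ assms]) (auto simp: D_var_def common_identities_def var_def)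
qed

lemma C2_satisfies:
  assumes "occ2 p = occ2 q"
  shows "(p, q) \<in> common_identities (C2_var :: 'a monoid set)"
proof -
  interpret fully_invariant "common_identities (C2_var :: 'a monoid set)"
    by (intro fully_invariant_identities monoid_variety_five)
  have cube: "([0,0], [0,0,0]) \<in> common_identities (C2_var :: 'a monoid set)"
    and comm: "([0,1], [1,0]) \<in> common_identities (C2_var :: 'a monoid set)"
    by (auto simp: C2_var_def common_identities_def var_def)
  have "(sort p, sort q) \<in> common_identities (C2_var :: 'a monoid set)"
    using cong_left[OF comm, of "[0]"] cong_right[OF comm, of "[0]"]
    by (intro D_derivable[OF cube _ _ occ2_sort[OF assms]]) simp_all
  then show ?thesis using sort_derivable[OF comm] sym trans by blast
qed

text \<open>
  In a semilattice every letter may be doubled, after which all letters are multiple and only the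
  content matters in \<open>D_derivable\<close>.
\<close>

lemma SL_satisfies:
  assumes "set p = set q"
  shows "(p, q) \<in> common_identities (SL_var :: 'a monoid set)"
proof -
  interpret fully_invariant "common_identities (SL_var :: 'a monoid set)"
    by (intro fully_invariant_identities monoid_variety_five)
  have idem: "([0,0], [0]) \<in> common_identities (SL_var :: 'a monoid set)"
    and comm: "([0,1], [1,0]) \<in> common_identities (SL_var :: 'a monoid set)"
    by (auto simp: SL_var_eq common_identities_def var_def)
  let ?d = "\<lambda>x. [x, x]"
  have "([x], [x, x]) \<in> common_identities (SL_var :: 'a monoid set)" for x
    using sym[OF subst[OF idem, of "\<lambda>_. [x]"]] by simp
  then have dbl: "(r, subst_word ?d r) \<in> common_identities (SL_var :: 'a monoid set)" for r
    using subst_pointwise[of "\<lambda>x. [x]" ?d r] by simp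
  have count: "count_list (subst_word ?d r) x = 2 * count_list r x" for r x
    by (induction r) auto
  have ge: "2 \<le> count_list (subst_word ?d r) x" if "x \<in> set r" for r x
    using that count_list_0_iff[of r x] unfolding count by linarith
  have "set (subst_word ?d r) = set r" for r by (induction r) auto
  then have doubled: "occ2 (subst_word ?d p) = occ2 (subst_word ?d q)"
    "simple_part (subst_word ?d p) = simple_part (subst_word ?d q)"
    using assms ge by (intro occ2_all_multiple; simp)+
  have cube: "([0,0], [0,0,0]) \<in> common_identities (SL_var :: 'a monoid set)"
    using sym[OF cong_left[OF idem, of "[0]"]] by simp
  have "(subst_word ?d p, subst_word ?d q) \<in> common_identities (SL_var :: 'a monoid set)"
    by (rule D_derivable[OF cube _ _ doubled])
      (use cong_left[OF comm, of "[0]"] cong_right[OF comm, of "[0]"] in simp_all)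
  then show ?thesis using dbl sym trans by blast
qed

lemma SL_identities:
  assumes inf: "infinite (UNIV :: 'a set)" and "(p, q) \<in> common_identities (SL_var :: 'a monoid set)"
  shows "set p = set q"
proof (rule common_identities_var_syntactic[OF inf])
  show "(p, q) \<in> common_identities (var {([0,0], [0]), ([0,1], [1,0])} :: 'a monoid set)"
    using assms(2) by (simp add: SL_var_eq)
qed (auto simp: syntactic_def)

lemma C2_identities:
  assumes inf: "infinite (UNIV :: 'a set)" and "(p, q) \<in> common_identities (C2_var :: 'a monoid set)"
  shows "occ2 p = occ2 q"
proof (rule common_identities_var_syntactic[OF inf])
  show "(p, q) \<in> common_identities (var {([0,0], [0,0,0]), ([0,1], [1,0])} :: 'a monoid set)"
    using assms(2) by (simp add: C2_var_def)
  have "min 2 (c + (k + (k + d))) = min 2 (c + (k + (k + (k + d))))" for c k d :: nat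
    by (cases k) simp_all
  then show "{([0,0], [0,0,0]), ([0,1], [1,0])} \<subseteq> syntactic occ2"
    by (auto simp: syntactic_def occ2_def fun_eq_iff add.left_commute)
qed

lemma SL_subset_C2:
  assumes "infinite (UNIV :: 'a set)"
  shows "(SL_var :: 'a monoid set) \<subseteq> C2_var"
proof -
  have "(p, q) \<in> common_identities (SL_var :: 'a monoid set)"
    if "(p, q) \<in> common_identities (C2_var :: 'a monoid set)" for p q
    using C2_identities[OF assms that] by (intro SL_satisfies occ2_set)
  then show ?thesis
    unfolding variety_subset_iff[OF monoid_variety_five(2,3)] by (rule subrelI)
qed

lemma C2_subset_D: "(C2_var :: 'a monoid set) \<subseteq> D_var"
proof -
  have eq: "occ2 [0,0] = occ2 [0,0,0]" "occ2 [0,0,1] = occ2 [0,1,0]" "occ2 [0,1,0] = occ2 [1,0,0]"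
    by (rule ext; simp add: occ2_def)+
  have "{([0,0], [0,0,0]), ([0,0,1], [0,1,0]), ([0,1,0], [1,0,0])} \<subseteq> common_identities (C2_var :: 'a monoid set)"
    using eq by (blast intro: C2_satisfies)
  then show ?thesis
    unfolding D_var_def variety_subset_var_iff[OF monoid_variety_five(3)] .
qed

lemma T_subset_variety:
  fixes V :: "'a monoid set"
  assumes "monoid_variety V"
  shows "T_var \<subseteq> V"
proof -
  have "(p, q) \<in> common_identities (T_var :: 'a monoid set)" for p q
  proof -
    have "word_val M \<phi> p = word_val M \<phi> q"
      if "monoid M" "carrier M = {\<one>\<^bsub>M\<^esub>}" "\<phi> \<in> UNIV \<rightarrow> carrier M" for M :: "'a monoid" and \<phi>
      using monoid.word_val_closed[OF that(1,3)] that(2) by (metis singletonD)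
    then show ?thesis by (auto simp: common_identities_def T_var_def satisfies_def)
  qed
  then show ?thesis
    unfolding variety_subset_iff[OF monoid_variety_five(1) assms] by auto
qed

section \<open>Varieties that omit a small variety\<close>

text \<open>
  Erase all letters other than \<open>x\<close> and \<open>y\<close>, and rename these to \<open>0\<close> and \<open>1\<close>.  If \<open>x = y\<close>,
  a single letter is kept.
\<close>

definition keep_two :: "nat \<Rightarrow> nat \<Rightarrow> nat \<Rightarrow> nat list"
  where "keep_two x y z = (if z = x then [0] else if z = y then [1] else [])"

lemma subst_word_keep_two_in:
  "subst_word (keep_two x y) w \<in> two_letter_words (count_list w x) (if x = y then 0 else count_list w y)"
  by (induction w) (auto simp: two_letter_words_def keep_two_def)

text \<open>
  The letters at the first position where the words differ will do.
\<close>

lemma exists_distinguishing_letters: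
  "u \<noteq> v \<Longrightarrow> \<exists>x y. subst_word (keep_two x y) u \<noteq> subst_word (keep_two x y) v"
proof (induction u arbitrary: v)
  case Nil
  then obtain b v' where "v = b # v'" by (cases v) auto
  then show ?case by (intro exI[of _ b]) (auto simp: keep_two_def)
next
  case (Cons a u)
  show ?case
  proof (cases v)
    case Nil
    then show ?thesis by (intro exI[of _ a]) (auto simp: keep_two_def)
  next
    case (Cons b v')
    show ?thesis
    proof (cases "a = b")
      case True
      then show ?thesis using Cons.IH[of v'] Cons.prems Cons by simp
    next
      case False
      then show ?thesis using Cons by (intro exI[of _ a] exI[of _ b]) (auto simp: keep_two_def)
    qed
  qed
qed

lemma two_letter_words_unique:
  assumes "u \<in> two_letter_words n m" "v \<in> two_letter_words n m" "n = 0 \<or> m = 0"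
  shows "u = v"
  using subst_word_erase_0[of _ n m "\<lambda>x. [x]"] subst_word_erase_1[of _ n m "\<lambda>x. [x]"] assms
  by auto

lemma two_letter_words_1_1: "w \<in> two_letter_words 1 1 \<Longrightarrow> w = [0, 1] \<or> w = [1, 0]"
proof -
  assume w: "w \<in> two_letter_words 1 1"
  then have "length w = 2" using length_two_letter_words by fastforce
  then obtain a b where "w = [a, b]" by (auto simp: numeral_2_eq_2 length_Suc_conv)
  then show ?thesis using w by (auto simp: two_letter_words_def split: if_splits)
qed

context
  fixes V :: "'a monoid set"
  assumes inf: "infinite (UNIV :: 'a set)" and V: "monoid_variety V"
begin

interpretation \<theta>: fully_invariant "common_identities V"
  using V by (rule fully_invariant_identities)

lemma not_SL_imp_group:
  assumes "\<not> SL_var \<subseteq> V"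
  shows "\<exists>n\<ge>1. (replicate n 0, []) \<in> common_identities V"
proof -
  obtain p q where pq: "(p, q) \<in> common_identities V"
    and fails: "(p, q) \<notin> common_identities (SL_var :: 'a monoid set)"
    using assms unfolding variety_subset_iff[OF monoid_variety_five(2) V] by auto
  have neq: "set p \<noteq> set q"
    using SL_satisfies fails by blast
  have *: "\<exists>n\<ge>1. (replicate n 0, []) \<in> common_identities V"
    if "(p, q) \<in> common_identities V" "x \<in> set p" "x \<notin> set q" for p q x
  proof -
    have "(replicate (count_list p x) 0, []) \<in> common_identities V"
      using \<theta>.subst[OF that(1), of "\<lambda>z. if z = x then [0] else []"] that(3)
      unfolding subst_word_single by simp
    moreover have "count_list p x \<ge> 1"
      using that(2) count_list_0_iff[of p x] by linarith
    ultimately show ?thesis by blast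
  qed
  show ?thesis
    using neq *[OF pq] *[OF \<theta>.sym[OF pq]] by blast
qed

lemma SL_imp_content_preserved:
  assumes "SL_var \<subseteq> V" "(p, q) \<in> common_identities V"
  shows "set p = set q"
  using assms SL_identities[OF inf, of p q]
  unfolding variety_subset_iff[OF monoid_variety_five(2) V] by blast

lemma C2_imp_occ2_preserved:
  assumes "C2_var \<subseteq> V" "(p, q) \<in> common_identities V"
  shows "occ2 p = occ2 q"
  using assms C2_identities[OF inf, of p q]
  unfolding variety_subset_iff[OF monoid_variety_five(3) V] by blast

lemma not_C2_imp_completely_regular:
  assumes SL: "SL_var \<subseteq> V" and "\<not> C2_var \<subseteq> V"
  shows "\<exists>k\<ge>2. ([0], replicate k 0) \<in> common_identities V"
proof -
  obtain p q where pq: "(p, q) \<in> common_identities V"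
    and fails: "(p, q) \<notin> common_identities (C2_var :: 'a monoid set)"
    using assms unfolding variety_subset_iff[OF monoid_variety_five(3) V] by auto
  have neq: "occ2 p \<noteq> occ2 q"
    using C2_satisfies fails by blast
  from neq obtain x where x: "min 2 (count_list p x) \<noteq> min 2 (count_list q x)"
    by (auto simp: occ2_def fun_eq_iff)
  have "count_list p x = 0 \<longleftrightarrow> count_list q x = 0"
    using SL_imp_content_preserved[OF SL pq] by (simp add: count_list_0_iff)
  then have "count_list p x = 1 \<and> count_list q x \<ge> 2 \<or> count_list q x = 1 \<and> count_list p x \<ge> 2"
    using x by linarith
  moreover have "(replicate (count_list p x) 0, replicate (count_list q x) 0) \<in> common_identities V"
    using \<theta>.subst[OF pq, of "\<lambda>z. if z = x then [0] else []"] unfolding subst_word_single .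
  ultimately show ?thesis using \<theta>.sym by auto
qed

text \<open>
  An identity of \<open>V\<close> that fails in \<open>D\<close> must change the order of two letters that occur once,
  since containing \<open>C\<^sub>2\<close> forces the values of \<open>occ2\<close> to agree.  Erasing all other letters
  leaves \<open>xy \<approx> yx\<close>.
\<close>

lemma not_D_imp_commutative:
  assumes C2: "C2_var \<subseteq> V" and "\<not> D_var \<subseteq> V"
  shows "([0,1], [1,0]) \<in> common_identities V"
proof -
  obtain p q where pq: "(p, q) \<in> common_identities V"
    and fails: "(p, q) \<notin> common_identities (D_var :: 'a monoid set)"
    using assms(2) unfolding variety_subset_iff[OF monoid_variety_five(4) V] by auto
  have occ: "occ2 p = occ2 q" using C2 pq by (rule C2_imp_occ2_preserved)
  then have "simple_part p \<noteq> simple_part q" using D_satisfies fails by blast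
  then obtain x y where xy:
    "subst_word (keep_two x y) (simple_part p) \<noteq> subst_word (keep_two x y) (simple_part q)"
    using exists_distinguishing_letters by blast
  have count: "count_list (simple_part p) z = count_list (simple_part q) z" for z
    using occ2_count_1[OF occ, of z] by (simp add: simple_part_def)
  define n m where "n = count_list (simple_part p) x"
    and "m = (if x = y then 0 else count_list (simple_part p) y)"
  have W: "subst_word (keep_two x y) (simple_part p) \<in> two_letter_words n m"
    unfolding n_def m_def by (rule subst_word_keep_two_in)
  have W': "subst_word (keep_two x y) (simple_part q) \<in> two_letter_words n m"
    unfolding n_def m_def count by (rule subst_word_keep_two_in)
  have "n \<noteq> 0" "m \<noteq> 0"
    using two_letter_words_unique[OF W W'] xy by metis+
  then have simple: "count_list p x = 1" "count_list p y = 1" and "n = 1" "m = 1"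
    by (auto simp: n_def m_def simple_part_def split: if_splits)
  then have simple': "count_list q x = 1" "count_list q y = 1"
    using occ2_count_1[OF occ] by blast+
  have keep: "subst_word (keep_two x y) (filter P r) = subst_word (keep_two x y) r" if "P x" "P y" for P r
    using that by (induction r) (auto simp: keep_two_def)
  have "(subst_word (keep_two x y) (simple_part p), subst_word (keep_two x y) (simple_part q))
      \<in> common_identities V"
    using \<theta>.subst[OF pq, of "keep_two x y"] keep simple simple' by (simp add: simple_part_def)
  then show ?thesis
    using two_letter_words_1_1 W W' xy \<theta>.sym unfolding \<open>n = 1\<close> \<open>m = 1\<close> by metis
qed

lemma subvariety_of_D:
  assumes "V \<subseteq> D_var"
  shows "V = T_var \<or> V = SL_var \<or> V = C2_var \<or> V = D_var"
proof -
  have D: "([0,0], [0,0,0]) \<in> common_identities V" "([0,0,1], [0,1,0]) \<in> common_identities V"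
    "([0,1,0], [1,0,0]) \<in> common_identities V"
    using assms unfolding D_var_def variety_subset_var_iff[OF V] by auto
  have absorb: "(replicate a 0, replicate b 0) \<in> common_identities V" if "2 \<le> a" "2 \<le> b" for a b
    using \<theta>.replicate_absorb[of 2 0 a b] D(1) that by (simp add: numeral_2_eq_2)
  consider "D_var \<subseteq> V" | "\<not> SL_var \<subseteq> V" | "SL_var \<subseteq> V" "\<not> C2_var \<subseteq> V"
    | "C2_var \<subseteq> V" "\<not> D_var \<subseteq> V"
    by blast
  then show ?thesis
  proof cases
    case 1
    then show ?thesis using assms by blast
  next
    case 2
    then obtain n where n: "n \<ge> 1" "(replicate n 0, []) \<in> common_identities V"
      using not_SL_imp_group by blast
    have dbl: "(replicate (n + n) 0, []) \<in> common_identities V"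
      using \<theta>.append[OF n(2) n(2)] by (simp add: replicate_add)
    have "([0], replicate (n + n + 1) 0) \<in> common_identities V"
      using \<theta>.sym[OF \<theta>.cong_left[OF dbl, of "[0]"]] by simp
    also have "(replicate (n + n + 1) 0, replicate (n + n) 0) \<in> common_identities V"
      using n(1) by (intro absorb) simp_all
    also note dbl
    finally have "V \<subseteq> T_var" unfolding T_var_eq variety_subset_var_iff[OF V] by simp
    then show ?thesis using T_subset_variety[OF V] by blast
  next
    case 3
    then obtain k where k: "k \<ge> 2" "([0], replicate k 0) \<in> common_identities V"
      using not_C2_imp_completely_regular by blast
    then have idem: "([0], [0,0]) \<in> common_identities V"
      using \<theta>.trans[OF k(2) absorb[of k 2]] by (simp add: numeral_2_eq_2)
    have "([0,1], [0,0,1]) \<in> common_identities V"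
      using \<theta>.cong_right[OF idem, of "[1]"] by simp
    also note D(2)
    also note D(3)
    also have "([1,0,0], [1,0]) \<in> common_identities V"
      using \<theta>.sym[OF \<theta>.cong_left[OF idem, of "[1]"]] by simp
    finally have "V \<subseteq> SL_var"
      using \<theta>.sym[OF idem] unfolding SL_var_eq variety_subset_var_iff[OF V] by simp
    then show ?thesis using 3 by blast
  next
    case 4
    then have "V \<subseteq> C2_var"
      using not_D_imp_commutative D(1) unfolding C2_var_def variety_subset_var_iff[OF V] by simp
    then show ?thesis using 4 by blast
  qed
qed

end

section \<open>The five varieties are cancellable\<close>

text \<open>
  Each of the three transfer lemmas moves all identities of \<open>Y\<close> to \<open>Z\<close>, once those that agree on
  \<open>occ2\<close> and \<open>simple_part\<close>, and so hold in \<open>D\<close>, can be moved.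
\<close>

lemma concat_replicate_mult:
  "concat (replicate n (concat (replicate j r))) = concat (replicate (n * j) r)"
  by (induction n) (auto simp: replicate_add)

lemma group_transfer:
  assumes Y: "monoid_variety Y" and Z: "monoid_variety Z"
    and n: "n \<ge> 1" "(replicate n 0, []) \<in> common_identities Y"
    and m: "m \<ge> 1" "(replicate m 0, []) \<in> common_identities Z"
    and D: "\<And>p q. (p, q) \<in> common_identities Y \<Longrightarrow> occ2 p = occ2 q \<Longrightarrow>
      simple_part p = simple_part q \<Longrightarrow> (p, q) \<in> common_identities Z"
  shows "common_identities Y \<subseteq> common_identities Z"
proof safe
  interpret Y: fully_invariant "common_identities Y" using Y by (rule fully_invariant_identities)
  interpret Z: fully_invariant "common_identities Z" using Z by (rule fully_invariant_identities)
  fix p q assume pq: "(p, q) \<in> common_identities Y"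
  \<comment> \<open>a power that is trivial in \<open>Z\<close>; the factor \<open>2\<close> makes every letter of \<open>p\<close> and \<open>q\<close> multiple\<close>
  define R where "R = concat (replicate (2 * n * m) (p @ q))"
  have "R = concat (replicate m (concat (replicate (2 * n) (p @ q))))"
    by (simp add: R_def concat_replicate_mult mult.commute mult.left_commute)
  then have R: "(R, []) \<in> common_identities Z"
    using Z.subst[OF m(2), of "\<lambda>_. concat (replicate (2 * n) (p @ q))"] by simp
  have "count_list R x \<ge> 2" if "x \<in> set (p @ q)" for x
  proof -
    have "count_list (p @ q) x \<ge> 1"
      using that count_list_0_iff[of "p @ q" x] by linarith
    moreover have "n * m \<ge> 1" using n(1) m(1) by simp
    ultimately have "(n * m) * count_list (p @ q) x \<ge> 1 * 1"
      by (rule mult_le_mono[rotated])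
    moreover have "count_list R x = 2 * ((n * m) * count_list (p @ q) x)"
      unfolding R_def count_list_concat_replicate by simp
    ultimately show ?thesis by linarith
  qed
  moreover have "set R = set (p @ q)"
    using n(1) m(1) by (auto simp: R_def)
  ultimately have "occ2 (p @ R) = occ2 (q @ R)" "simple_part (p @ R) = simple_part (q @ R)"
    by (intro occ2_all_multiple; force simp: trans_le_add2)+
  then have "(p @ R, q @ R) \<in> common_identities Z"
    using D Y.cong_right[OF pq] by blast
  then show "(p, q) \<in> common_identities Z"
    using Z.cong_left[OF R, of p] Z.cong_left[OF R, of q] Z.sym Z.trans by (metis append_Nil2)
qed

lemma (in fully_invariant) completely_regular_power:
  assumes "([0], replicate (1 + a) 0) \<in> \<alpha>"
  shows "([0], replicate (1 + a * j) 0) \<in> \<alpha>"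
proof (induction j)
  case (Suc j)
  have "(replicate (1 + a * j) 0, replicate (1 + a * Suc j) 0) \<in> \<alpha>"
    using cong_right[OF assms, of "replicate (a * j) 0"]
    by (simp add: replicate_add[symmetric] add.assoc)
  with Suc show ?case by (rule trans)
qed simp

lemma completely_regular_transfer:
  fixes Y Z :: "'a monoid set"
  assumes inf: "infinite (UNIV :: 'a set)" and Y: "monoid_variety Y" and Z: "monoid_variety Z"
    and SL: "SL_var \<subseteq> Y"
    and k: "k \<ge> 2" "([0], replicate k 0) \<in> common_identities Y"
    and l: "l \<ge> 2" "([0], replicate l 0) \<in> common_identities Z"
    and D: "\<And>p q. (p, q) \<in> common_identities Y \<Longrightarrow> occ2 p = occ2 q \<Longrightarrow>
      simple_part p = simple_part q \<Longrightarrow> (p, q) \<in> common_identities Z"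
  shows "common_identities Y \<subseteq> common_identities Z"
proof safe
  interpret Y: fully_invariant "common_identities Y" using Y by (rule fully_invariant_identities)
  interpret Z: fully_invariant "common_identities Z" using Z by (rule fully_invariant_identities)
  fix p q assume pq: "(p, q) \<in> common_identities Y"
  \<comment> \<open>\<open>x \<approx> x\<^sup>k\<close> and \<open>x \<approx> x\<^sup>l\<close> have the common consequence \<open>x \<approx> x\<^sup>K\<close>, and \<open>K \<ge> 2\<close>\<close>
  define K where "K = 1 + (k - 1) * (l - 1)"
  have K: "([0], replicate K 0) \<in> common_identities Z"
    using Z.completely_regular_power[of "l - 1" "k - 1"] l by (simp add: K_def mult.commute)
  have "(k - 1) * (l - 1) \<ge> 1 * 1" using k(1) l(1) by (intro mult_le_mono) simp_all
  then have "K \<ge> 2" by (simp add: K_def)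
  define \<phi> where "\<phi> x = replicate K x" for x :: nat
  have "([x], \<phi> x) \<in> common_identities Z" for x
    using Z.subst[OF K, of "\<lambda>_. [x]"] by (simp add: \<phi>_def)
  then have expand: "(r, subst_word \<phi> r) \<in> common_identities Z" for r
    using Z.subst_pointwise[of "\<lambda>x. [x]" \<phi> r] by simp
  have count: "count_list (subst_word \<phi> r) x = K * count_list r x" for r x
    by (induction r) (auto simp: \<phi>_def)
  have set: "set (subst_word \<phi> r) = set r" for r
    using \<open>K \<ge> 2\<close> by (induction r) (auto simp: \<phi>_def)
  have "2 \<le> count_list (subst_word \<phi> r) x" if "x \<in> set r" for r x
  proof -
    have "count_list r x \<ge> 1" using that count_list_0_iff[of r x] by linarith
    with \<open>K \<ge> 2\<close> have "2 * 1 \<le> K * count_list r x" by (rule mult_le_mono)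
    then show ?thesis by (simp add: count)
  qed
  moreover have "set p = set q"
    using SL_imp_content_preserved[OF inf Y SL pq] .
  ultimately have "occ2 (subst_word \<phi> p) = occ2 (subst_word \<phi> q)"
    "simple_part (subst_word \<phi> p) = simple_part (subst_word \<phi> q)"
    by (intro occ2_all_multiple; simp add: set)+
  then have "(subst_word \<phi> p, subst_word \<phi> q) \<in> common_identities Z"
    using D Y.subst[OF pq] by blast
  then show "(p, q) \<in> common_identities Z"
    using expand Z.sym Z.trans by blast
qed

lemma commutative_transfer:
  fixes Y Z :: "'a monoid set"
  assumes inf: "infinite (UNIV :: 'a set)" and Y: "monoid_variety Y" and Z: "monoid_variety Z"
    and C2: "C2_var \<subseteq> Y"
    and comm: "([0,1], [1,0]) \<in> common_identities Y" "([0,1], [1,0]) \<in> common_identities Z"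
    and D: "\<And>p q. (p, q) \<in> common_identities Y \<Longrightarrow> occ2 p = occ2 q \<Longrightarrow>
      simple_part p = simple_part q \<Longrightarrow> (p, q) \<in> common_identities Z"
  shows "common_identities Y \<subseteq> common_identities Z"
proof safe
  interpret Y: fully_invariant "common_identities Y" using Y by (rule fully_invariant_identities)
  interpret Z: fully_invariant "common_identities Z" using Z by (rule fully_invariant_identities)
  fix p q assume pq: "(p, q) \<in> common_identities Y"
  then have "(sort p, sort q) \<in> common_identities Y"
    using Y.sort_derivable[OF comm(1)] Y.sym Y.trans by blast
  then have "(sort p, sort q) \<in> common_identities Z"
    using D occ2_sort[OF C2_imp_occ2_preserved[OF inf Y C2 pq]] by blast
  then show "(p, q) \<in> common_identities Z"
    using Z.sort_derivable[OF comm(2)] Z.sym Z.trans by blast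
qed

lemma cancellation_of_identities:
  fixes V Y Z :: "'a monoid set"
  assumes inf: "infinite (UNIV :: 'a set)" and "V = T_var \<or> V = SL_var \<or> V = C2_var \<or> V = D_var"
    and Y: "monoid_variety Y" and Z: "monoid_variety Z"
    and join: "common_identities (V \<union> Y) = common_identities (V \<union> Z)" and meet: "V \<inter> Y = V \<inter> Z"
  shows "common_identities Y \<subseteq> common_identities Z"
proof -
  have V: "monoid_variety V" using assms(2) monoid_variety_five by blast
  have chain: "SL_var \<subseteq> V" if "V \<noteq> T_var"
    using that assms(2) SL_subset_C2[OF inf] C2_subset_D by blast
  have "V \<subseteq> D_var"
    using assms(2) T_subset_variety[OF monoid_variety_five(4)] SL_subset_C2[OF inf] C2_subset_D by blast
  then have "common_identities (D_var :: 'a monoid set) \<subseteq> common_identities V"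
    unfolding variety_subset_iff[OF V monoid_variety_five(4)] .
  then have D: "(p, q) \<in> common_identities Z" if "(p, q) \<in> common_identities Y" "occ2 p = occ2 q"
    "simple_part p = simple_part q" for p q
    using D_satisfies[OF that(2,3)] that(1) join unfolding common_identities_Un by blast
  have same: "U \<subseteq> Y \<longleftrightarrow> U \<subseteq> Z" if "U \<subseteq> V" for U
    using meet that by blast
  show ?thesis
  proof (cases "V \<subseteq> Y")
    case True
    then have "V \<union> Y = Y" "V \<union> Z = Z" using same by blast+
    then show ?thesis using join by simp
  next
    case V_not: False
    then have "V \<noteq> T_var" using T_subset_variety[OF Y] by blast
    then have SL: "SL_var \<subseteq> V" by (rule chain)
    show ?thesis
    proof (cases "SL_var \<subseteq> Y")
      case False
      then have "\<not> SL_var \<subseteq> Z" using same[OF SL] by simp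
      then show ?thesis
        using not_SL_imp_group[OF inf Y False] not_SL_imp_group[OF inf Z] group_transfer[OF Y Z] D by metis
    next
      case SLY: True
      then have SLZ: "SL_var \<subseteq> Z" using same[OF SL] by simp
      have C2: "C2_var \<subseteq> V"
        using assms(2) V_not SLY \<open>V \<noteq> T_var\<close> C2_subset_D by blast
      show ?thesis
      proof (cases "C2_var \<subseteq> Y")
        case False
        then have "\<not> C2_var \<subseteq> Z" using same[OF C2] by simp
        then show ?thesis
          using not_C2_imp_completely_regular[OF inf Y SLY False]
            not_C2_imp_completely_regular[OF inf Z SLZ] completely_regular_transfer[OF inf Y Z SLY] D
          by metis
      next
        case C2Y: True
        then have "V = D_var"
          using assms(2) V_not SLY \<open>V \<noteq> T_var\<close> by blast
        then have "\<not> D_var \<subseteq> Y" "\<not> D_var \<subseteq> Z" using V_not same[of V] by auto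
        moreover have "C2_var \<subseteq> Z" using C2Y same[OF C2] by simp
        ultimately show ?thesis
          using commutative_transfer[OF inf Y Z C2Y] not_D_imp_commutative[OF inf Y C2Y]
            not_D_imp_commutative[OF inf Z] D by metis
      qed
    qed
  qed
qed

lemma cancellable_small_variety:
  fixes V :: "'a monoid set"
  assumes inf: "infinite (UNIV :: 'a set)" and small: "V = T_var \<or> V = SL_var \<or> V = C2_var \<or> V = D_var"
  shows "cancellable MON_lattice V"
proof -
  have V: "monoid_variety V" using small monoid_variety_five by blast
  have "Y = Z" if Y: "monoid_variety Y" and Z: "monoid_variety Z"
    and join: "V \<squnion>\<^bsub>MON_lattice\<^esub> Y = V \<squnion>\<^bsub>MON_lattice\<^esub> Z"
    and meet: "V \<sqinter>\<^bsub>MON_lattice\<^esub> Y = V \<sqinter>\<^bsub>MON_lattice\<^esub> Z" for Y Z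
  proof -
    have meet': "V \<inter> Y = V \<inter> Z"
      using meet by (simp add: meet_MON_lattice V Y Z)
    have var: "var (common_identities (V \<union> Y)) = (var (common_identities (V \<union> Z)) :: 'a monoid set)"
      using join by (simp add: join_MON_lattice V Y Z)
    have closed: "common_identities (var (common_identities K) :: 'a monoid set) = common_identities K"
      if "\<And>M. M \<in> K \<Longrightarrow> monoid M" for K :: "'a monoid set"
    proof
      have "K \<subseteq> var (common_identities K)"
        using that by (auto simp: common_identities_def var_def)
      then show "common_identities (var (common_identities K) :: 'a monoid set) \<subseteq> common_identities K"
        by (rule common_identities_antimono)
    qed (auto simp: common_identities_def var_def)
    have join': "common_identities (V \<union> Y) = common_identities (V \<union> Z)"
      using closed[of "V \<union> Y"] closed[of "V \<union> Z"] var monoid_variety_monoid V Y Z by (metis UnE)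
    have "common_identities Y = common_identities Z"
      using cancellation_of_identities[OF inf small Y Z join' meet']
        cancellation_of_identities[OF inf small Z Y join'[symmetric] meet'[symmetric]] by blast
    then show ?thesis
      using var_common_identities Y Z by metis
  qed
  then show ?thesis
    using V by (auto simp: cancellable_def MON_lattice_def)
qed

lemma cancellable_MON: "cancellable MON_lattice (MON_var :: 'a monoid set)"
proof -
  have "Y \<subseteq> MON_var" if "monoid_variety Y" for Y :: "'a monoid set"
    using monoid_variety_monoid[OF that] by (auto simp: MON_var_def)
  then have "Y = Z" if "monoid_variety Y" "monoid_variety Z"
    "MON_var \<sqinter>\<^bsub>MON_lattice\<^esub> Y = MON_var \<sqinter>\<^bsub>MON_lattice\<^esub> Z" for Y Z :: "'a monoid set"
    using that by (metis meet_MON_lattice monoid_variety_five(5) inf.absorb_iff2)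
  then show ?thesis
    using monoid_variety_five(5) by (auto simp: cancellable_def MON_lattice_def)
qed

section \<open>No other variety is cancellable\<close>

text \<open>
  A two-letter identity whose sides have the same numbers of occurrences is padded so that these
  numbers become \<open>n\<close> and \<open>n + 1\<close>.  Then \<open>V\<close> identifies all words of this shape, in particular
  the two that \<open>cancellable_imp_periodic_at\<close> asks for.  If the numbers of occurrences differ,
  periodicity is immediate.
\<close>

lemma proper_cancellable_imp_periodic:
  fixes V :: "'a monoid set"
  assumes inf: "infinite (UNIV :: 'a set)" and V: "monoid_variety V"
    and canc: "cancellable MON_lattice V" and proper: "V \<noteq> MON_var"
  shows "\<exists>s. \<exists>k\<ge>1. (replicate s 0, replicate (s + k) 0) \<in> common_identities V"
proof -
  interpret \<theta>: fully_invariant "common_identities V"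
    using V by (rule fully_invariant_identities)
  have powers: ?thesis if "(replicate a 0, replicate c 0) \<in> common_identities V" "a \<noteq> c" for a c
  proof (cases "a < c")
    case True
    then show ?thesis using that by (intro exI[of _ a] exI[of _ "c - a"]) simp
  next
    case False
    then show ?thesis using that \<theta>.sym by (intro exI[of _ c] exI[of _ "a - c"]) simp
  qed
  obtain u v where uv: "(u, v) \<in> common_identities V" "u \<noteq> v"
  proof -
    have "V = MON_var" if "\<forall>(u, v) \<in> common_identities V. u = v"
    proof -
      have "var (common_identities V) = (MON_var :: 'a monoid set)"
        using that by (auto simp: var_def MON_var_def satisfies_def)
      then show ?thesis using var_common_identities[OF V] by simp
    qed
    then show ?thesis using proper that by blast
  qed
  then obtain x y where "subst_word (keep_two x y) u \<noteq> subst_word (keep_two x y) v"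
    using exists_distinguishing_letters by blast
  then obtain p q where pq: "(p, q) \<in> common_identities V" "p \<noteq> q"
    "set p \<subseteq> {0, 1}" "set q \<subseteq> {0, 1}"
    using \<theta>.subst[OF uv(1), of "keep_two x y"] subst_word_keep_two_in
    unfolding two_letter_words_def by blast
  define a b where "a = count_list p 0" and "b = count_list p 1"
  have counts: "(replicate (count_list p z) 0, replicate (count_list q z) 0) \<in> common_identities V" for z
    using \<theta>.subst[OF pq(1), of "\<lambda>x. if x = z then [0] else []"] unfolding subst_word_single .
  show ?thesis
  proof (cases "count_list q 0 = a \<and> count_list q 1 = b")
    case False
    then show ?thesis using powers[OF counts[of 0]] powers[OF counts[of 1]] by (auto simp: a_def b_def)
  next
    case True
    \<comment> \<open>large enough for the padding exponents \<open>n - a\<close> and \<open>n + 1 - b\<close> not to be truncated, and at least \<open>2\<close>\<close>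
    define n where "n = a + b + 2"
    define pad where "pad r = replicate (n - a) 0 @ r @ replicate (n + 1 - b) (1::nat)" for r
    have W: "pad p \<in> two_letter_words n (n + 1)" "pad q \<in> two_letter_words n (n + 1)"
      using pq(3,4) True unfolding two_letter_words_def pad_def
      by (auto simp: a_def b_def n_def)
    have "pad p \<noteq> pad q" "(pad p, pad q) \<in> common_identities V"
      using pq(1,2) \<theta>.cong by (simp_all add: pad_def)
    then have full: "(w, pad p) \<in> common_identities V" if "w \<in> two_letter_words n (n + 1)" for w
      using cancellable_two_letter_collapse[OF inf V canc _ W that] by simp
    have "(replicate (n - 1) 0 @ replicate (n + 1) 1 @ [0], replicate n 0 @ replicate (n + 1) 1)
        \<in> common_identities V"
      by (rule \<theta>.trans[OF full \<theta>.sym[OF full]])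
        (auto simp: two_letter_words_def n_def)
    moreover have "n \<ge> 2" by (simp add: n_def)
    ultimately have "\<exists>k\<ge>1. (replicate n 0, replicate (n + k) 0) \<in> common_identities V"
      by (intro cancellable_imp_periodic_at[OF inf V canc, of n "n + 1"]) simp_all
    then show ?thesis by blast
  qed
qed

text \<open>
  Let \<open>s\<close> be least with \<open>x\<^sup>s \<approx> x\<^sup>s\<^sup>+\<^sup>1\<close>.  Since \<open>V\<close> identifies \<open>x\<^sup>stx\<^sup>s\<^sup>+\<^sup>1\<close> with
  \<open>x\<^sup>s\<^sup>+\<^sup>1tx\<^sup>s\<close>, it identifies all words with one \<open>t\<close> and \<open>2s + 1\<close> letters \<open>x\<close>, and this
  makes \<open>x\<^sup>s\<close> central.
\<close>

lemma aperiodic_cancellable: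
  fixes V :: "'a monoid set"
  assumes inf: "infinite (UNIV :: 'a set)" and V: "monoid_variety V"
    and canc: "cancellable MON_lattice V"
    and "(replicate r 0, replicate (r + 1) 0) \<in> common_identities V"
  shows "V = T_var \<or> V = SL_var \<or> V = C2_var \<or> V = D_var"
proof -
  interpret \<theta>: fully_invariant "common_identities V"
    using V by (rule fully_invariant_identities)
  define s where "s = (LEAST r. (replicate r (0::nat), replicate (r + 1) 0) \<in> common_identities V)"
  have s: "(replicate s 0, replicate (s + 1) 0) \<in> common_identities V"
    unfolding s_def using assms(4) by (rule LeastI)
  have least: "(replicate r 0, replicate (r + 1) 0) \<notin> common_identities V" if "r < s" for r
    using not_less_Least that unfolding s_def by blast
  have absorb: "(replicate i x, replicate j x) \<in> common_identities V" if "s \<le> i" "s \<le> j" for i j x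
    using \<theta>.replicate_absorb[of s x i j] \<theta>.subst[OF s, of "\<lambda>_. [x]"] that by simp
  have central: "(replicate s 0 @ [1], 1 # replicate s 0) \<in> common_identities V"
  proof (cases "s = 0")
    case False
    have slide: "(replicate (s + i) 0 @ [1] @ replicate (s + j) 0,
        replicate (s + i') 0 @ [1] @ replicate (s + j') 0) \<in> common_identities V" for i j i' j'
      by (intro \<theta>.append absorb) simp_all
    have "(replicate (2 * s + 1) 0 @ [1], replicate (s + 1) 0 @ [1] @ replicate s 0) \<in> common_identities V"
      by (rule cancellable_two_letter_collapse[OF inf V canc, of "2 * s + 1" 1 _ "replicate s 0 @ [1] @ replicate (s + 1) 0"])
        (use False slide[of 1 0 0 1] in \<open>auto simp: two_letter_words_def append_eq_append_conv2\<close>)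
    moreover have "(1 # replicate (2 * s + 1) 0, replicate (s + 1) 0 @ [1] @ replicate s 0) \<in> common_identities V"
      by (rule cancellable_two_letter_collapse[OF inf V canc, of "2 * s + 1" 1 _ "replicate s 0 @ [1] @ replicate (s + 1) 0"])
        (use False slide[of 1 0 0 1] in \<open>auto simp: two_letter_words_def append_eq_append_conv2\<close>)
    ultimately have "(replicate (2 * s + 1) 0 @ [1], [1] @ replicate (2 * s + 1) 0) \<in> common_identities V"
      using \<theta>.trans \<theta>.sym by (metis append_Cons append_Nil)
    then have "(replicate s 0 @ [1], [1] @ replicate s 0) \<in> common_identities V"
      using \<theta>.cong_right[OF absorb[of s "2 * s + 1" 0], of "[1]"]
        \<theta>.cong_left[OF absorb[of "2 * s + 1" s 0], of "[1]"] \<theta>.trans by (metis le_add1 mult_2 order_refl trans_le_add1)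
    then show ?thesis by simp
  qed simp
  consider "s = 0" | "s = 1" | "s = 2" | "s \<ge> 3" by linarith
  then show ?thesis
  proof cases
    case 1
    then have "V \<subseteq> T_var"
      using \<theta>.sym[OF s] unfolding T_var_eq variety_subset_var_iff[OF V] by simp
    then show ?thesis using T_subset_variety[OF V] by blast
  next
    case 2
    then have "V \<subseteq> SL_var"
      using \<theta>.sym[OF s] central unfolding SL_var_eq variety_subset_var_iff[OF V] by simp
    then have "V \<subseteq> D_var" using SL_subset_C2[OF inf] C2_subset_D by blast
    then show ?thesis by (rule subvariety_of_D[OF inf V])
  next
    case 3
    have c: "([0,0,1], [1,0,0]) \<in> common_identities V"
      using central 3 by (simp add: numeral_2_eq_2)
    have m: "([0,1,0], [0,0,1]) \<in> common_identities V"
      by (rule cancellable_two_letter_collapse[OF inf V canc, of 2 1 _ "[1,0,0]"])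
        (use c in \<open>auto simp: two_letter_words_def\<close>)
    have "V \<subseteq> D_var"
      using s 3 \<theta>.sym[OF m] \<theta>.trans[OF m c] unfolding D_var_def variety_subset_var_iff[OF V]
      by (simp add: numeral_2_eq_2)
    then show ?thesis by (rule subvariety_of_D[OF inf V])
  next
    case 4
    have "(replicate s 1 @ [0], 0 # replicate s 1) \<in> common_identities V"
      using \<theta>.subst[OF central, of "\<lambda>z. if z = 0 then [1] else [0]"] by simp
    then have "(replicate (s - 1 - 1) 0 @ replicate s 1 @ [0], replicate (s - 1 - 1) 0 @ 0 # replicate s 1)
        \<in> common_identities V"
      by (rule \<theta>.cong_left)
    moreover have "replicate (s - 1 - 1) 0 @ 0 # replicate s 1 = replicate (s - 1) 0 @ replicate s (1::nat)"
    proof -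
      have "s - 1 = Suc (s - 1 - 1)" using 4 by simp
      then show ?thesis by (metis replicate_app_Cons_same replicate_Suc append_Cons)
    qed
    ultimately have "(replicate (s - 1 - 1) 0 @ replicate s 1 @ [0], replicate (s - 1) 0 @ replicate s 1)
        \<in> common_identities V"
      by (simp only:)
    then have "\<exists>k\<ge>1. (replicate (s - 1) 0, replicate (s - 1 + k) 0) \<in> common_identities V"
      using 4 by (intro cancellable_imp_periodic_at[OF inf V canc, of "s - 1" s]) simp_all
    then obtain k where "k \<ge> 1" "(replicate (s - 1) 0, replicate (s - 1 + k) 0) \<in> common_identities V"
      by blast
    then have "(replicate (s - 1) 0, replicate (s - 1 + 1) 0) \<in> common_identities V"
      using \<theta>.trans[OF _ absorb[of "s - 1 + k" "s - 1 + 1" 0]] 4 by simp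
    then show ?thesis using least[of "s - 1"] 4 by simp
  qed
qed

theorem theorem1p1:
  fixes V :: "'a monoid set"
  assumes "infinite (UNIV :: 'a set)"
    and "monoid_variety V"
  shows "cancellable MON_lattice V \<longleftrightarrow>
    V = T_var \<or> V = SL_var \<or> V = C2_var \<or> V = D_var \<or> V = MON_var"
proof
  assume canc: "cancellable MON_lattice V"
  show "V = T_var \<or> V = SL_var \<or> V = C2_var \<or> V = D_var \<or> V = MON_var"
  proof (cases "V = MON_var")
    case False
    then obtain s k where "k \<ge> 1" "(replicate s 0, replicate (s + k) 0) \<in> common_identities V"
      using proper_cancellable_imp_periodic[OF assms canc] by blast
    then have "\<exists>r. (replicate r 0, replicate (r + 1) 0) \<in> common_identities V"
      by (rule cancellable_periodic_imp_aperiodic[OF assms canc])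
    then show ?thesis
      using aperiodic_cancellable[OF assms canc] by blast
  qed simp
next
  assume "V = T_var \<or> V = SL_var \<or> V = C2_var \<or> V = D_var \<or> V = MON_var"
  then show "cancellable MON_lattice V"
    using cancellable_small_variety[OF assms(1)] cancellable_MON by blast
qed

end
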